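(* There exist absolute constants $c>0$ and $M$ such that, for every integer $m\geq M$, there is a polynomial $F\in\mathbb{Q}[x]$ with $|\operatorname{supp}(F)|=m$ such that every irreducible factor $G$ of $F$ over $\mathbb{Q}$ satisfies $$|\operatorname{supp}(G)|>\exp\!\left(c\sqrt{\frac{m}{\log m}}\right).$$
   Context: For a nonzero polynomial $P(x)=\sum_{j=0}^{d}a_jx^j\in\mathbb{Q}[x]$, $\operatorname{supp}(P)=\{j\in\{0,\ldots,d\}:a_j\neq 0\}$, so $|\operatorname{supp}(P)|$ is the number of nonzero coefficients (terms) of $P$. Irreducible factors are nonconstant irreducible elements of $\mathbb{Q}[x]$ dividing $F$. *)

theory Defs
  imports Complex_Main "HOL-Computational_Algebra.Computational_Algebra"
begin

definition supp :: "'a::zero poly \<Rightarrow> nat set"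
  where "supp P = {j \<in> {0..degree P}. coeff P j \<noteq> 0}"

end

(*
Let n be the product of a set A of k primes p in [sqrt N, N], and let Phi be the n-th cyclotomic
polynomial. It divides every Psi_p = (1 - x^n) / (1 - x^(n/p)), which has only p terms, hence also
F = sum_p c_p Psi_p = (1 - x^n) W, where W = sum_p c_p / (1 - x^(n/p)) and c_p > 0. Since
Re (1 / (1 - w)) >= 1/2 on the closed unit disc, W has no zero there, so the zeros of F in the disc
are n-th roots of unity at which no Psi_p survives: the roots of Phi, all simple. So H = F / Phi
has all its roots outside the disc; if H(0), up to sign the sum of the c_p, is prime, then H is
irreducible, and the irreducible factors of F are Phi and H.

Both have exponentially many terms in k. The function g(u) = log Phi (exp (- exp u)) arises from
u |-> log (1 - exp (- exp u)) by applying the difference operators g(u + log p) - g(u), p in A. Its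
Mellin transform gets a factor p^(-z) - 1 for each p, and for a suitable z of size 1 / log N all these
factors are at least 1.3 in modulus, but at most 1/2 at Re z. This forces g to take values above
exp (k/6) and below - exp (k/6), so Phi is huge at some point of (0,1) and H = F / Phi at another one.
Near x = 1 both are of moderate size, because their cofactors are at least 1 on [1, oo). A polynomial
with few terms cannot grow that much (an inequality of Turan type). The number of terms of F is about
k N, and Chebyshev's bound allows k to be of order N / log N.
*)
theory Submission
  imports Defs "HOL-Analysis.Analysis" "HOL-Computational_Algebra.Field_as_Ring"
    "HOL-Real_Asymp.Real_Asymp"
begin

section \<open>Integer polynomials and Gauss' lemma\<close>

text \<open>One point z has to make all the factors p^(-z) - 1 large at once, so ln p / ln N must
  stay in a fixed interval; this is why the primes start at sqrt N, where it is [1/2, 1]. The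
  imaginary part 4 pi / (3 ln N) then turns every p^(-z) to within pi / 3 of the negative real axis.
  A large transform alone would only give a large |g| of unknown sign. Both signs are needed, a
  large Phi for one factor and a small Phi for the other, and the tiny value at the real point Re z
  supplies them: the weighted positive and negative parts of g nearly balance. The number of terms
  must be exactly m, so a further multiple of 1 - x^n of adjustable length \<open>r\<close> is added
  to the sum over p; the weights are large enough to keep W free of zeros in the disc. Their sum
  also has to be prime, and a crude bound q! + 1 for this prime is good enough because coefficients
  enter the final estimate only through a logarithm, which is compared with exp (k/6). The balance
  is N about sqrt (m ln m) and k about N / (8 ln N), so that k N is at most m / 4 and k has order
  sqrt (m / ln m).\<close>

definition int_to_rat_poly :: "int poly \<Rightarrow> rat poly" where
  "int_to_rat_poly = map_poly of_int"

definition int_to_cpx_poly :: "int poly \<Rightarrow> complex poly" where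
  "int_to_cpx_poly = map_poly of_int"

lemma coeff_int_to_rat_poly [simp]: "coeff (int_to_rat_poly P) i = of_int (coeff P i)"
  by (simp add: int_to_rat_poly_def coeff_map_poly)

lemma coeff_int_to_cpx_poly [simp]: "coeff (int_to_cpx_poly P) i = of_int (coeff P i)"
  by (simp add: int_to_cpx_poly_def coeff_map_poly)

lemma int_to_rat_poly_add [simp]:
  "int_to_rat_poly (P + Q) = int_to_rat_poly P + int_to_rat_poly Q"
  by (rule poly_eqI) simp

lemma int_to_rat_poly_mult [simp]:
  "int_to_rat_poly (P * Q) = int_to_rat_poly P * int_to_rat_poly Q"
  by (rule poly_eqI) (simp add: coeff_mult)

lemma int_to_rat_poly_smult [simp]:
  "int_to_rat_poly (smult c P) = smult (of_int c) (int_to_rat_poly P)"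
  by (rule poly_eqI) simp

lemma int_to_rat_poly_eq_iff [simp]: "int_to_rat_poly P = int_to_rat_poly Q \<longleftrightarrow> P = Q"
  by (simp add: poly_eq_iff)

lemma int_to_rat_poly_0 [simp]: "int_to_rat_poly 0 = 0"
  by (rule poly_eqI) simp

lemma int_to_cpx_poly_add [simp]:
  "int_to_cpx_poly (P + Q) = int_to_cpx_poly P + int_to_cpx_poly Q"
  by (rule poly_eqI) simp

lemma int_to_cpx_poly_diff [simp]:
  "int_to_cpx_poly (P - Q) = int_to_cpx_poly P - int_to_cpx_poly Q"
  by (rule poly_eqI) simp

lemma int_to_cpx_poly_sum [simp]:
  "int_to_cpx_poly (\<Sum>i\<in>I. f i) = (\<Sum>i\<in>I. int_to_cpx_poly (f i))"
  by (rule poly_eqI) (simp add: coeff_sum)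

lemma int_to_cpx_poly_mult [simp]:
  "int_to_cpx_poly (P * Q) = int_to_cpx_poly P * int_to_cpx_poly Q"
  by (rule poly_eqI) (simp add: coeff_mult)

lemma int_to_cpx_poly_1 [simp]: "int_to_cpx_poly 1 = 1"
  by (simp add: int_to_cpx_poly_def map_poly_1)

lemma int_to_cpx_poly_power [simp]: "int_to_cpx_poly (P ^ n) = int_to_cpx_poly P ^ n"
  by (induction n) auto

lemma int_to_cpx_poly_smult [simp]:
  "int_to_cpx_poly (smult c P) = smult (of_int c) (int_to_cpx_poly P)"
  by (rule poly_eqI) simp

lemma int_to_cpx_poly_pCons [simp]:
  "int_to_cpx_poly (pCons a P) = pCons (of_int a) (int_to_cpx_poly P)"
  by (rule poly_eqI) (simp add: coeff_pCons split: nat.split)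

lemma int_to_cpx_poly_monom [simp]: "int_to_cpx_poly (monom c n) = monom (of_int c) n"
  by (rule poly_eqI) simp

lemma int_to_cpx_poly_eq_iff [simp]: "int_to_cpx_poly P = int_to_cpx_poly Q \<longleftrightarrow> P = Q"
  by (simp add: poly_eq_iff)

lemma int_to_cpx_poly_0 [simp]: "int_to_cpx_poly 0 = 0"
  by (rule poly_eqI) simp

lemma degree_int_to_cpx_poly [simp]: "degree (int_to_cpx_poly P) = degree P"
  unfolding int_to_cpx_poly_def by (rule degree_map_poly) auto

lemma int_to_cpx_poly_pderiv: "int_to_cpx_poly (pderiv P) = pderiv (int_to_cpx_poly P)"
  by (rule poly_eqI) (simp add: coeff_pderiv)

lemma int_to_cpx_poly_pcompose [simp]:
  "int_to_cpx_poly (pcompose P Q) = pcompose (int_to_cpx_poly P) (int_to_cpx_poly Q)"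
  by (induction P) (auto simp: pcompose_pCons)

text \<open>Pseudo-division multiplies the dividend by a power of the leading coefficient of
  \<open>B\<close>; for monic \<open>B\<close> this power is 1, so it is a genuine division over
  \<open>int\<close>.\<close>

lemma int_monic_division:
  fixes P B :: "int poly"
  assumes "lead_coeff B = 1"
  obtains Q R where "P = B * Q + R" "R = 0 \<or> degree R < degree B"
proof -
  obtain Q R where QR: "pseudo_divmod P B = (Q, R)" by force
  have "B \<noteq> 0" using assms by auto
  from pseudo_divmod[OF this QR] assms have "P = B * Q + R" "R = 0 \<or> degree R < degree B"
    by auto
  then show ?thesis using that by blast
qed

text \<open>Divide over \<open>int\<close> and compare with the complex quotient: the remainder is a
  complex multiple of \<open>B\<close> of lower degree, hence 0. The integral cofactors of
  cyclotomic polynomials come from here.\<close>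

lemma int_monic_dvd_complex:
  fixes P B :: "int poly"
  assumes "lead_coeff B = 1" and "int_to_cpx_poly P = int_to_cpx_poly B * Q"
  obtains Q' where "P = B * Q'" "int_to_cpx_poly Q' = Q"
proof -
  obtain Q' R where QR: "P = B * Q' + R" "R = 0 \<or> degree R < degree B"
    using int_monic_division[OF assms(1)] by metis
  have B0: "int_to_cpx_poly B \<noteq> 0" using assms(1)
    by (metis int_to_cpx_poly_0 int_to_cpx_poly_eq_iff lead_coeff_1 leading_coeff_0_iff zero_neq_one)
  have R: "int_to_cpx_poly R = int_to_cpx_poly B * (Q - int_to_cpx_poly Q')"
    using assms(2) QR(1) by (simp add: algebra_simps)
  have "R = 0"
  proof (rule ccontr)
    assume "R \<noteq> 0"
    then have "degree R < degree B" "int_to_cpx_poly R \<noteq> 0"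
      using QR(2) by (auto simp flip: int_to_cpx_poly_0)
    moreover from this have "degree (int_to_cpx_poly R) \<ge> degree (int_to_cpx_poly B)"
      using dvd_imp_degree_le[OF dvdI[OF R]] by blast
    ultimately show False by simp
  qed
  with R B0 have "int_to_cpx_poly Q' = Q" by auto
  with \<open>R = 0\<close> QR(1) that show ?thesis by auto
qed

lemma rat_poly_clear_denominators:
  fixes Q :: "rat poly"
  obtains d :: int and P where "d > 0" "smult (of_int d) Q = int_to_rat_poly P"
proof -
  define d where "d = (\<Prod>i\<le>degree Q. snd (quotient_of (coeff Q i)))"
  have pos: "d > 0"
    unfolding d_def by (intro prod_pos) (metis quotient_of_denom_pos surjective_pairing)
  have int: "of_int d * coeff Q i \<in> \<int>" for i
  proof (cases "i \<le> degree Q")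
    case True
    have "coeff Q i = of_int (fst (quotient_of (coeff Q i))) / of_int (snd (quotient_of (coeff Q i)))"
      by (intro quotient_of_div) simp
    moreover have "snd (quotient_of (coeff Q i)) dvd d"
      unfolding d_def using True by (intro dvd_prodI) auto
    moreover have "snd (quotient_of (coeff Q i)) \<noteq> 0"
      by (metis quotient_of_denom_pos surjective_pairing less_irrefl)
    ultimately show ?thesis
      by (smt (verit, ccfv_threshold) Ints_of_int dvdE mult.commute mult.left_commute 
          nonzero_mult_div_cancel_left of_int_0_eq_iff of_int_mult times_divide_eq_right)
  qed (simp add: coeff_eq_0)
  then obtain P where "smult (of_int d) Q = map_poly of_int P"
    using intpolyE[of "smult (of_int d) Q"] by (auto simp: Ints_def)
  then show ?thesis using that[OF pos] by (simp add: int_to_rat_poly_def)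
qed

lemma rat_poly_primitive_int:
  fixes Q :: "rat poly"
  assumes "Q \<noteq> 0"
  obtains c P where "c \<noteq> 0" "Q = smult c (int_to_rat_poly P)" "Polynomial.content P = 1"
proof -
  obtain d P where d: "d > 0" "smult (of_int d) Q = int_to_rat_poly P"
    using rat_poly_clear_denominators by blast
  have "P \<noteq> 0" using d assms by auto
  have "Q = smult (1 / of_int d) (int_to_rat_poly P)"
    using d by (simp flip: d(2))
  moreover have "int_to_rat_poly P = smult (of_int (Polynomial.content P)) (int_to_rat_poly (primitive_part P))"
    by (simp flip: int_to_rat_poly_smult)
  ultimately have "Q = smult (of_int (Polynomial.content P) / of_int d) (int_to_rat_poly (primitive_part P))"
    by simp
  moreover have "Polynomial.content (primitive_part P) = 1" using \<open>P \<noteq> 0\<close> by simp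
  ultimately show ?thesis using that[of "of_int (Polynomial.content P) / of_int d"] \<open>P \<noteq> 0\<close> d(1) by auto
qed

text \<open>Clearing the denominators of the quotient gives d F = P R over \<open>int\<close>.
  Contents are multiplicative and that of \<open>P\<close> is 1, so \<open>d\<close> divides the
  content of \<open>R\<close> and cancels.\<close>

lemma gauss_int_dvd:
  assumes "Polynomial.content P = 1" "int_to_rat_poly P dvd int_to_rat_poly F"
  shows "P dvd F"
proof -
  obtain Q where Q: "int_to_rat_poly F = int_to_rat_poly P * Q" using assms(2) by auto
  obtain d R where d: "d > 0" "smult (of_int d) Q = int_to_rat_poly R"
    using rat_poly_clear_denominators by blast
  have "int_to_rat_poly (smult d F) = int_to_rat_poly (P * R)"
    by (simp add: Q flip: d(2))
  then have eq: "smult d F = P * R" by (simp only: int_to_rat_poly_eq_iff)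
  then have "Polynomial.content R = d * Polynomial.content F" using d(1) assms(1)
    by (metis content_mult content_smult mult_1 normalize_mult normalize_content abs_of_pos normalize_int_def)
  then have "[:d:] dvd R" by (simp add: const_poly_dvd_iff_dvd_content)
  then obtain S where "R = smult d S" by auto
  with eq d(1) have "F = P * S" by (metis mult_smult_right order_less_irrefl smult_cancel)
  then show ?thesis by simp
qed

text \<open>Otherwise the two polynomials are coprime over the rationals. A Bezout identity, cleared
  of denominators and evaluated at the common root \<open>z\<close>, would give 0 = c d with c, d >
  0.\<close>

lemma irreducible_int_dvd_if_common_root:
  assumes "Polynomial.content P = 1" "irreducible (int_to_rat_poly P)"
    and "poly (int_to_cpx_poly P) z = 0" "poly (int_to_cpx_poly M) z = 0"
  shows "P dvd M"
proof (rule gauss_int_dvd[OF assms(1)], rule ccontr)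
  assume "\<not> int_to_rat_poly P dvd int_to_rat_poly M"
  then have "coprime (int_to_rat_poly P) (int_to_rat_poly M)"
    using assms(2) by (intro prime_elem_imp_coprime field_poly_irreducible_imp_prime)
  then obtain S T where ST: "S * int_to_rat_poly P + T * int_to_rat_poly M = 1"
    by (metis bezout_coefficients_fst_snd coprime_iff_gcd_eq_1)
  obtain c S' where S: "c > 0" "smult (of_int c) S = int_to_rat_poly S'"
    using rat_poly_clear_denominators by blast
  obtain d T' where T: "d > 0" "smult (of_int d) T = int_to_rat_poly T'"
    using rat_poly_clear_denominators by blast
  have "int_to_rat_poly (smult d (S' * P) + smult c (T' * M))
      = smult (of_int (c * d)) (S * int_to_rat_poly P + T * int_to_rat_poly M)"
    by (simp add: smult_add_right mult.commute flip: S(2) T(2))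
  also have "\<dots> = int_to_rat_poly [:c * d:]"
    by (simp only: ST) (simp add: int_to_rat_poly_def map_poly_pCons)
  finally have "smult d (S' * P) + smult c (T' * M) = [:c * d:]"
    by (simp only: int_to_rat_poly_eq_iff)
  then have "poly (int_to_cpx_poly (smult d (S' * P) + smult c (T' * M))) z = of_int (c * d)"
    by simp
  then show False using assms(3,4) S(1) T(1) by simp
qed

section \<open>Irreducibility of cyclotomic polynomials of squarefree order\<close>

lemma prime_power_add_cong:
  fixes u v :: "'a::comm_ring_1"
  assumes "prime (p::nat)"
  shows "\<exists>c. (u + v) ^ p = u ^ p + v ^ p + of_nat p * c"
proof -
  have p: "p > 0" using assms prime_gt_0_nat by blast
  have "(u + v) ^ p = (\<Sum>k\<le>p. of_nat (p choose k) * u ^ k * v ^ (p - k))"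
    by (rule binomial_ring)
  also have "{..p} = insert 0 (insert p {0<..<p})" using p by auto
  also have "(\<Sum>k\<in>\<dots>. of_nat (p choose k) * u ^ k * v ^ (p - k))
      = v ^ p + u ^ p + (\<Sum>k\<in>{0<..<p}. of_nat (p choose k) * u ^ k * v ^ (p - k))"
    using p by (simp add: add.assoc)
  also have "(\<Sum>k\<in>{0<..<p}. of_nat (p choose k) * u ^ k * v ^ (p - k))
      = (\<Sum>k\<in>{0<..<p}. of_nat p * (of_nat ((p choose k) div p) * u ^ k * v ^ (p - k)))"
  proof (rule sum.cong[OF refl])
    fix k assume k: "k \<in> {0<..<p}"
    then have "p dvd (p choose k)"
      using dvd_choose_prime[of k p] assms by auto
    then have "p choose k = p * ((p choose k) div p)" by simp
    then have "(of_nat (p choose k) :: 'a) = of_nat p * of_nat ((p choose k) div p)"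
      by (metis of_nat_mult)
    then show "of_nat (p choose k) * u ^ k * v ^ (p - k)
        = of_nat p * (of_nat ((p choose k) div p) * u ^ k * v ^ (p - k))"
      by (simp add: mult.assoc)
  qed
  finally show ?thesis by (auto simp: sum_distrib_left[symmetric] add.commute)
qed

lemma prime_power_int_cong:
  assumes "prime (p::nat)"
  shows "\<exists>c. (a::int) ^ p = a + int p * c"
proof -
  have p: "p > 0" using assms prime_gt_0_nat by blast
  have nat: "\<exists>c. (int n) ^ p = int n + int p * c" for n
  proof (induction n)
    case 0
    show ?case using p by (intro exI[of _ 0]) auto
  next
    case (Suc n)
    then obtain c where c: "(int n) ^ p = int n + int p * c" by auto
    obtain d where "(int n + 1) ^ p = (int n) ^ p + 1 ^ p + of_nat p * d"
      using prime_power_add_cong[OF assms] by blast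
    then show ?case using c by (intro exI[of _ "c + d"]) (simp add: algebra_simps)
  qed
  show ?thesis
  proof (cases "a \<ge> 0")
    case True
    then show ?thesis using nat[of "nat a"] by auto
  next
    case False
    then obtain c where c: "(- a) ^ p = - a + int p * c" using nat[of "nat (- a)"] by auto
    \<comment> \<open>Expanding (a + (- a))^p = 0 settles negative \<open>a\<close> without a
      distinction by the parity of \<open>p\<close>.\<close>
    obtain d where "(a + (- a)) ^ p = a ^ p + (- a) ^ p + of_nat p * d"
      using prime_power_add_cong[OF assms] by blast
    moreover have "(a + (- a)) ^ p = 0" using p by simp
    ultimately have "0 = a ^ p + (- a + int p * c) + int p * d" unfolding c by linarith
    then show ?thesis by (intro exI[of _ "- c - d"]) (simp add: algebra_simps)
  qed
qed

text \<open>Induction on the coefficients: write the polynomial as a + x h, apply the binomial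
  congruence once, and use Fermat's congruence for the constant a.\<close>

lemma poly_frobenius_cong:
  fixes h :: "int poly"
  assumes "prime (p::nat)"
  shows "\<exists>k. pcompose h (monom 1 p) = h ^ p + smult (int p) k"
proof (induction h)
  case 0
  show ?case using assms prime_gt_0_nat by (intro exI[of _ 0]) auto
next
  case (pCons a h)
  then obtain k where k: "pcompose h (monom 1 p) = h ^ p + smult (int p) k" by auto
  have eq: "pCons a h = [:a:] + monom 1 1 * h" by (simp add: monom_altdef)
  obtain c where c: "(pCons a h) ^ p = [:a:] ^ p + (monom 1 1 * h) ^ p + of_nat p * c"
    unfolding eq using prime_power_add_cong[OF assms] by blast
  obtain d where d: "a ^ p = a + int p * d" using prime_power_int_cong[OF assms] by auto
  have "pcompose (pCons a h) (monom 1 p) = [:a:] + monom 1 p * (h ^ p + smult (int p) k)"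
    by (simp add: pcompose_pCons k)
  also have "monom 1 p * h ^ p = (monom 1 1 * h) ^ p"
    by (simp add: power_mult_distrib monom_power)
  then have "[:a:] + monom 1 p * (h ^ p + smult (int p) k)
      = [:a:] + (monom 1 1 * h) ^ p + smult (int p) (monom 1 p * k)"
    by (simp add: algebra_simps)
  also have "\<dots> = (pCons a h) ^ p + smult (int p) (monom 1 p * k - c - [:d:])"
    by (simp add: c d poly_const_pow of_nat_poly smult_diff_right smult_add_right)
  finally show ?case by blast
qed

text \<open>Dedekind's argument. Write \<open>x\<^sup>n - 1 = P h\<close>. Differentiating gives
  \<open>z P'(z) h(z) = n\<close>, so if \<open>h(z\<^sup>p) = 0\<close>, the congruence \<open>h(x\<^sup>p) \<equiv> h(x)\<^sup>p\<close> modulo \<open>p\<close>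
  makes \<open>n\<^sup>p\<close> a multiple of \<open>p\<close> in \<open>\<int>[z]\<close>.\<close>

lemma root_power_prime:
  fixes P :: "int poly" and z :: complex
  assumes P: "lead_coeff P = 1" "irreducible (int_to_rat_poly P)" "poly (int_to_cpx_poly P) z = 0"
    and z: "z ^ n = 1" and n: "n > 0" and p: "prime p" "\<not> p dvd n"
  shows "poly (int_to_cpx_poly P) (z ^ p) = 0"
proof (rule ccontr)
  assume nz: "poly (int_to_cpx_poly P) (z ^ p) \<noteq> 0"
  have cP: "Polynomial.content P = 1"
    using P(1) by (metis content_dvd_coeff is_unit_content_iff)
  have "P dvd monom 1 n - 1"
    by (rule irreducible_int_dvd_if_common_root[OF cP P(2,3)]) (simp add: poly_monom z)
  then obtain h where h: "monom 1 n - 1 = P * h" by auto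
  have "poly (int_to_cpx_poly (monom 1 n - 1)) (z ^ p) = 0"
    using z by (simp add: poly_monom power_mult[symmetric] mult.commute[of p])
       (simp add: power_mult)
  then have hz: "poly (int_to_cpx_poly h) (z ^ p) = 0" using nz by (simp add: h)
  obtain k where k: "pcompose h (monom 1 p) = h ^ p + smult (int p) k"
    using poly_frobenius_cong[OF p(1)] by blast
  define w where "w = poly (int_to_cpx_poly h) z"
  have wp: "w ^ p = - of_nat p * poly (int_to_cpx_poly k) z"
  proof -
    have "poly (int_to_cpx_poly (pcompose h (monom 1 p))) z = 0"
      using hz by (simp add: poly_pcompose poly_monom)
    then show ?thesis unfolding k by (simp add: w_def add_eq_0_iff2 poly_power)
  qed
  define B where "B = monom 1 1 * pderiv P"
  have Bw: "poly (int_to_cpx_poly B) z * w = of_nat n"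
  proof -
    have "pderiv (int_to_cpx_poly (monom 1 n - 1)) = pderiv (int_to_cpx_poly (P * h))"
      by (simp add: h)
    then have "poly (pderiv (monom (1::complex) n - 1)) z
        = poly (pderiv (int_to_cpx_poly P * int_to_cpx_poly h)) z"
      by simp
    then have "of_nat n * z ^ (n - 1) = poly (pderiv (int_to_cpx_poly P)) z * w"
      using P(3) by (simp add: pderiv_diff pderiv_monom poly_monom pderiv_mult w_def)
    then have "z * poly (pderiv (int_to_cpx_poly P)) z * w = of_nat n * (z * z ^ (n - 1))"
      by (metis mult.assoc mult.left_commute)
    also have "z * z ^ (n - 1) = 1" using z n by (metis power_eq_if not_gr_zero)
    finally show ?thesis by (simp add: B_def poly_monom int_to_cpx_poly_pderiv)
  qed
  \<comment> \<open>The relation obtained is n^p + p K(z) = 0. Replacing \<open>K\<close> by its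
    remainder \<open>R\<close> brings it below the degree of \<open>P\<close>; being divisible by
    \<open>P\<close>, the polynomial n^p + p R is then zero, and its constant coefficient gives p |
    n^p.\<close>
  define K where "K = B ^ p * k"
  obtain Q R where QR: "K = P * Q + R" "R = 0 \<or> degree R < degree P"
    using int_monic_division[OF P(1)] by metis
  have "of_nat n ^ p = poly (int_to_cpx_poly B) z ^ p * w ^ p"
    by (metis Bw power_mult_distrib)
  then have "of_nat n ^ p + of_nat p * poly (int_to_cpx_poly K) z = 0"
    by (simp add: wp K_def poly_power)
  then have "poly (int_to_cpx_poly ([:int n ^ p:] + smult (int p) R)) z = 0"
    using P(3) by (simp add: QR(1))
  then have dvd: "P dvd [:int n ^ p:] + smult (int p) R"
    by (rule irreducible_int_dvd_if_common_root[OF cP P(2,3)])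
  have "degree P > 0"
  proof (rule ccontr)
    assume "\<not> degree P > 0"
    then have "P = 1" using P(1) by (metis degree_0_id lead_coeff_1 neq0_conv one_pCons of_int_1 
       degree_eq_zeroE coeff_pCons_0 )
    then show False using P(3) by simp
  qed
  then have "degree ([:int n ^ p:] + smult (int p) R) < degree P"
    using QR(2) by (intro degree_add_less) (auto simp: degree_smult_eq)
  then have "[:int n ^ p:] + smult (int p) R = 0"
    using dvd dvd_imp_degree_le leD by blast
  then have "coeff ([:int n ^ p:] + smult (int p) R) 0 = 0" by simp
  then have "int p dvd int n ^ p" by (simp add: add_eq_0_iff2)
  then have "p dvd n" by (metis of_nat_power int_dvd_int_iff p(1) prime_dvd_power)
  with p(2) show False by simp
qed

text \<open>A prime factor p of \<open>a\<close> does not divide \<open>n\<close>, so z^p is again a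
  root of \<open>P\<close> and an \<open>n\<close>-th root of unity; the remaining exponent a / p is
  applied to it. Hence the induction on \<open>a\<close> has to let \<open>z\<close> vary.\<close>

lemma root_power_coprime:
  fixes P :: "int poly" and z :: complex
  assumes P: "lead_coeff P = 1" "irreducible (int_to_rat_poly P)" "poly (int_to_cpx_poly P) z = 0"
    and z: "z ^ n = 1" and n: "n > 0" and a: "a > 0" "coprime a n"
  shows "poly (int_to_cpx_poly P) (z ^ a) = 0"
  using a z P(3)
proof (induction a arbitrary: z rule: less_induct)
  case (less a)
  show ?case
  proof (cases "a = 1")
    case False
    then obtain p where p: "prime p" "p dvd a" using prime_factor_nat by blast
    then obtain b where b: "a = p * b" by auto
    have "\<not> p dvd n" using less.prems(2) p
      by (metis coprime_common_divisor_nat not_prime_1)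
    then have "poly (int_to_cpx_poly P) (z ^ p) = 0"
      using root_power_prime[OF P(1,2) less.prems(4,3) n p(1)] by simp
    moreover have "b < a" "b > 0" "coprime b n" "(z ^ p) ^ n = 1"
      using less.prems b p prime_gt_1_nat[OF p(1)]
      by (auto simp: power_mult[symmetric] mult.commute[of p n]) (simp add: power_mult)
    ultimately show ?thesis using less.IH[of b "z ^ p"] by (simp add: b power_mult)
  qed (use less.prems in simp)
qed

text \<open>For a finite set \<open>A\<close> of primes, these are the roots of unity of exact order \<open>\<Prod>A\<close>.\<close>

definition prim_roots :: "nat set \<Rightarrow> complex set" where
  "prim_roots A = {z. z ^ \<Prod>A = 1 \<and> (\<forall>p\<in>A. z ^ \<Prod>(A - {p}) \<noteq> 1)}"

text \<open>The cyclotomic polynomial of order \<open>\<Prod>A\<close>, indexed by the set of primes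
  rather than by the order so that facts can be proved by inserting one prime at a time. The
  induction starts from \<open>cyclo {}\<close>, which is x - 1.\<close>

definition cyclo :: "nat set \<Rightarrow> complex poly" where
  "cyclo A = (\<Prod>z\<in>prim_roots A. [:- z, 1:])"

lemma prod_linear_factors_dvd:
  fixes P :: "'a::field poly"
  assumes "finite S" "\<And>z. z \<in> S \<Longrightarrow> poly P z = 0"
  shows "(\<Prod>z\<in>S. [:- z, 1:]) dvd P"
  using assms
proof (induction S)
  case (insert x S)
  then obtain Q where Q: "P = (\<Prod>z\<in>S. [:- z, 1:]) * Q" by auto
  have "poly (\<Prod>z\<in>S. [:- z, 1:]) x \<noteq> 0" using insert.hyps by (auto simp: poly_prod)
  then have "poly Q x = 0" using insert.prems[of x] Q by simp
  then have "[:- x, 1:] dvd Q" by (simp add: poly_eq_0_iff_dvd)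
  then show ?case unfolding Q prod.insert[OF insert.hyps(1,2)] 
    by (metis mult.commute mult_dvd_mono dvd_refl)
qed simp

lemma lead_coeff_prod_linear:
  "lead_coeff (\<Prod>z\<in>S. [:- z, 1:]) = (1 :: 'a::field)"
  by (simp add: lead_coeff_prod)

lemma degree_prod_linear [simp]:
  "degree (\<Prod>z\<in>S. [:- (z::'a::field), 1:]) = card S"
  by (cases "finite S") (auto simp: degree_prod_eq_sum_degree)

lemma monic_dvd_degree_eq:
  fixes P Q :: "'a::field poly"
  assumes "P dvd Q" "lead_coeff P = 1" "lead_coeff Q = 1" "degree Q \<le> degree P"
  shows "P = Q"
proof -
  obtain R where R: "Q = P * R" using assms(1) by auto
  have "Q \<noteq> 0" "P \<noteq> 0" using assms by auto
  then have "degree Q = degree P + degree R" using R by (auto simp: degree_mult_eq)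
  then obtain c where c: "R = [:c:]" using assms(4) by (metis add_le_same_cancel1 degree_eq_zeroE le_zero_eq)
  then have "c = 1" using assms(2,3) R by (metis lead_coeff_mult mult_1 lead_coeff_pCons(2) pCons_0_0)
  then show ?thesis using R c by simp
qed

section \<open>Roots of unity of squarefree order\<close>

lemma prod_primes_pos: "(\<forall>p\<in>A. prime p) \<Longrightarrow> \<Prod>A > (0::nat)"
  by (simp add: prime_gt_0_nat prod_pos)

lemma finite_prim_roots:
  assumes "\<forall>p\<in>A. prime p"
  shows "finite (prim_roots A)"
proof (rule finite_subset)
  show "prim_roots A \<subseteq> {z. z ^ \<Prod>A = 1}" by (auto simp: prim_roots_def)
  show "finite {z::complex. z ^ \<Prod>A = 1}" using finite_nth_roots prod_primes_pos[OF assms] by blast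
qed

lemma prod_remove_insert:
  assumes "finite A" "p \<notin> A" "q \<in> A"
  shows "\<Prod>(insert p A - {q}) = (p::nat) * \<Prod>(A - {q})"
proof -
  have "insert p A - {q} = insert p (A - {q})" using assms by auto
  then show ?thesis using assms by simp
qed

lemma power_eq_1_coprime:
  fixes w :: complex
  assumes "w ^ a = 1" "w ^ b = 1" "coprime a (b::nat)"
  shows "w = 1"
proof (cases "a = 0")
  case True
  then show ?thesis using assms by auto
next
  case False
  then obtain x y where "a * x = b * y + gcd a b" using bezout_nat by blast
  then have "w ^ (a * x) = w ^ (b * y) * w" using assms(3) by (simp add: power_add)
  then show ?thesis using assms by (simp add: power_mult)
qed

text \<open>The root sets behind Phi_n(x^p) = Phi_pn(x) Phi_n(x) for a prime \<open>p\<close> not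
  dividing n; disjointness ensures that the right-hand side has no repeated root.\<close>

lemma power_mem_prim_roots_iff:
  assumes "finite A" "\<forall>p\<in>A. prime p" "prime p" "p \<notin> A"
  shows "z ^ p \<in> prim_roots A \<longleftrightarrow> z \<in> prim_roots (insert p A) \<union> prim_roots A"
    and "prim_roots (insert p A) \<inter> prim_roots A = {}"
proof -
  have ins: "\<Prod>(insert p A) = p * \<Prod>A" "\<Prod>(insert p A - {p}) = \<Prod>A"
    "\<And>q. q \<in> A \<Longrightarrow> \<Prod>(insert p A - {q}) = p * \<Prod>(A - {q})"
    using assms prod_remove_insert[OF assms(1,4)] by auto
  show "prim_roots (insert p A) \<inter> prim_roots A = {}"
    using assms by (auto simp: prim_roots_def ins)
  \<comment> \<open>The number z^(n/q) has \<open>q\<close>-th power 1. If its \<open>p\<close>-th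
    power were 1 too, coprimality of \<open>p\<close> and \<open>q\<close> would make it 1.\<close>
  have *: "z ^ (p * \<Prod>(A - {q})) \<noteq> 1" if "z \<in> prim_roots A" "q \<in> A" for q
  proof
    assume "z ^ (p * \<Prod>(A - {q})) = 1"
    then have "(z ^ \<Prod>(A - {q})) ^ p = 1" by (simp add: power_mult[symmetric] mult.commute)
    moreover have "(z ^ \<Prod>(A - {q})) ^ q = 1"
      using that prod.remove[OF assms(1) that(2), of "\<lambda>x. x"]
      by (simp add: power_mult[symmetric] prim_roots_def mult.commute)
    moreover have "coprime p q" using assms that by (metis primes_coprime)
    ultimately have "z ^ \<Prod>(A - {q}) = 1" by (rule power_eq_1_coprime)
    then show False using that by (auto simp: prim_roots_def)
  qed
  have **: "z ^ \<Prod>(A - {q}) \<noteq> 1" if "z ^ (p * \<Prod>(A - {q})) \<noteq> 1" for q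
    using that by (metis mult.commute power_mult power_one)
  show "z ^ p \<in> prim_roots A \<longleftrightarrow> z \<in> prim_roots (insert p A) \<union> prim_roots A"
  proof
    assume zp: "z ^ p \<in> prim_roots A"
    show "z \<in> prim_roots (insert p A) \<union> prim_roots A"
    proof (cases "z ^ \<Prod>A = 1")
      case True
      then have "z \<in> prim_roots A"
        using zp ** by (auto simp: prim_roots_def power_mult[symmetric])
      then show ?thesis by simp
    next
      case False
      then have "z \<in> prim_roots (insert p A)"
        using zp unfolding prim_roots_def mem_Collect_eq ball_simps ins
        by (auto simp: ins power_mult)
      then show ?thesis by simp
    qed
  next
    assume "z \<in> prim_roots (insert p A) \<union> prim_roots A"
    then show "z ^ p \<in> prim_roots A"
    proof
      assume "z \<in> prim_roots (insert p A)"
      then show ?thesis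
        unfolding prim_roots_def mem_Collect_eq ball_simps ins by (auto simp: ins power_mult)
    next
      assume z: "z \<in> prim_roots A"
      then have "z ^ (p * \<Prod>A) = 1" by (metis (mono_tags, lifting) mem_Collect_eq mult.commute power_mult power_one prim_roots_def)
      then show ?thesis using *[OF z] by (auto simp: prim_roots_def power_mult)
    qed
  qed
qed

lemma norm_prim_roots:
  assumes "\<forall>p\<in>A. prime p" "z \<in> prim_roots A"
  shows "norm z = 1"
proof -
  have "z ^ \<Prod>A = 1" using assms by (auto simp: prim_roots_def)
  then have "norm z ^ \<Prod>A = 1" by (metis norm_one norm_power)
  then show ?thesis using prod_primes_pos[OF assms(1)]
    by (metis norm_ge_zero power_eq_1_iff less_numeral_extra(3) abs_of_nonneg real_norm_def)
qed

text \<open>Both sides are monic, and every root of the right side is one of the left; the degrees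
  agree because each nonzero w has exactly \<open>p\<close> distinct \<open>p\<close>-th roots. This
  identity yields both the integrality of \<open>cyclo\<close> and the difference equation for its
  logarithm.\<close>

lemma cyclo_pcompose:
  assumes "finite A" "\<forall>p\<in>A. prime p" "prime p" "p \<notin> A"
  shows "pcompose (cyclo A) (monom 1 p) = cyclo (insert p A) * cyclo A"
proof -
  let ?S = "prim_roots (insert p A) \<union> prim_roots A"
  have p: "p > 0" using assms prime_gt_0_nat by blast
  have fin: "finite (prim_roots (insert p A))" "finite (prim_roots A)"
    using assms by (auto intro!: finite_prim_roots)
  have "?S = (\<Union>w\<in>prim_roots A. {z. z ^ p = w})"
    using power_mem_prim_roots_iff(1)[OF assms] by blast
  then have "card ?S = (\<Sum>w\<in>prim_roots A. card {z. z ^ p = w})"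
    using fin p by (simp only:) (intro card_UN_disjoint, auto intro: finite_nth_roots)
  also have "\<dots> = (\<Sum>w\<in>prim_roots A. p)"
  proof (rule sum.cong[OF refl])
    fix w assume "w \<in> prim_roots A"
    then have "w \<noteq> 0" using norm_prim_roots[OF assms(2)] by fastforce
    then show "card {z. z ^ p = w} = p" using p by (rule card_nth_roots)
  qed
  finally have card: "card ?S = card (prim_roots A) * p" by simp
  have "(\<Prod>z\<in>?S. [:- z, 1:]) = cyclo (insert p A) * cyclo A"
    unfolding cyclo_def using fin power_mem_prim_roots_iff(2)[OF assms] by (intro prod.union_disjoint) auto
  moreover have "(\<Prod>z\<in>?S. [:- z, 1:]) = pcompose (cyclo A) (monom 1 p)"
  proof (rule monic_dvd_degree_eq)
    show "(\<Prod>z\<in>?S. [:- z, 1:]) dvd pcompose (cyclo A) (monom 1 p)"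
    proof (rule prod_linear_factors_dvd)
      fix z assume "z \<in> ?S"
      then have "z ^ p \<in> prim_roots A" using power_mem_prim_roots_iff(1)[OF assms] by blast
      then show "poly (pcompose (cyclo A) (monom 1 p)) z = 0"
        using fin by (simp add: poly_pcompose poly_monom cyclo_def poly_prod)
    qed (use fin in auto)
    show "lead_coeff (pcompose (cyclo A) (monom 1 p)) = 1"
      using p lead_coeff_prod_linear[of "prim_roots A"]
      by (subst lead_coeff_comp) (auto simp: degree_monom_eq cyclo_def lead_coeff_monom)
    show "degree (pcompose (cyclo A) (monom 1 p)) \<le> degree (\<Prod>z\<in>?S. [:- z, 1:])"
      by (simp add: cyclo_def degree_pcompose degree_monom_eq card)
  qed (rule lead_coeff_prod_linear)
  ultimately show ?thesis by simp
qed

text \<open>By \<open>cyclo_pcompose\<close>, the polynomial for one more prime is a complex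
  quotient of an integer polynomial by a monic integer polynomial, so it is integral.\<close>

lemma cyclo_int:
  assumes "finite A" "\<forall>p\<in>A. prime p"
  obtains P :: "int poly" where "lead_coeff P = 1" "int_to_cpx_poly P = cyclo A"
proof -
  have "\<exists>P::int poly. lead_coeff P = 1 \<and> int_to_cpx_poly P = cyclo A"
    using assms
  proof (induction A)
    case empty
    have "prim_roots {} = {1}" by (auto simp: prim_roots_def)
    then show ?case by (intro exI[of _ "[:-1, 1:]"]) (simp add: cyclo_def)
  next
    case (insert p A)
    then obtain P :: "int poly" where P: "lead_coeff P = 1" "int_to_cpx_poly P = cyclo A" by auto
    have "int_to_cpx_poly (pcompose P (monom 1 p)) = int_to_cpx_poly P * cyclo (insert p A)"
      using cyclo_pcompose[of A p] insert by (simp add: P(2) mult.commute)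
    then obtain Q where Q: "int_to_cpx_poly Q = cyclo (insert p A)"
      using int_monic_dvd_complex[OF P(1)] by metis
    then have "of_int (lead_coeff Q) = (1 :: complex)"
      by (metis coeff_int_to_cpx_poly degree_int_to_cpx_poly cyclo_def lead_coeff_prod_linear)
    then show ?case using Q by auto
  qed
  then show ?thesis using that by auto
qed

text \<open>\<open>z\<close> has exact order n, so its first n powers are distinct and exhaust the
  n-th roots of unity by counting. A common prime factor of the exponent and n would lower the order
  of \<open>y\<close>.\<close>

lemma prim_roots_conjugate:
  assumes "finite A" "\<forall>p\<in>A. prime p" "A \<noteq> {}" "z \<in> prim_roots A" "y \<in> prim_roots A"
  obtains a where "a > 0" "coprime a (\<Prod>A)" "y = z ^ a"
proof -
  let ?n = "\<Prod>A"
  have n: "?n > 0" using prod_primes_pos assms(2) by blast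
  have zn: "z ^ ?n = 1" "y ^ ?n = 1" using assms by (auto simp: prim_roots_def)
  \<comment> \<open>The definition of \<open>prim_roots\<close> tests only the divisors n / p. Every
    proper divisor of n divides one of them, so these tests already force exact order n.\<close>
  have dvd_remove: "\<exists>p\<in>A. d dvd \<Prod>(A - {p})" if d: "d dvd ?n" "d < ?n" for d
  proof -
    obtain e where e: "?n = d * e" using d by auto
    then have "e \<noteq> 1" using d by auto
    then obtain p where p: "prime p" "p dvd e" using prime_factor_nat by blast
    then have "p dvd ?n" using e by simp
    then obtain q where "q \<in> A" "p dvd q" using prime_dvd_prod_iff[OF assms(1) p(1)] by auto
    then have "p \<in> A" using assms(2) p(1) primes_dvd_imp_eq by blast
    obtain f where f: "e = p * f" using p by auto
    have "p * \<Prod>(A - {p}) = p * (d * f)"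
      using prod.remove[OF assms(1) \<open>p \<in> A\<close>, of "\<lambda>x. x"] e f by (metis mult.left_commute)
    then have "\<Prod>(A - {p}) = d * f" using p(1) prime_gt_0_nat[of p] by (metis mult_left_cancel less_irrefl)
    then have "d dvd \<Prod>(A - {p})" by (metis dvd_triv_left)
    with \<open>p \<in> A\<close> show ?thesis by blast
  qed
  have order: "z ^ d \<noteq> 1" if d: "0 < d" "d < ?n" for d
  proof
    assume "z ^ d = 1"
    obtain s t where "d * s = ?n * t + gcd d ?n" using bezout_nat[of d ?n] d by blast
    then have "z ^ (d * s) = z ^ (?n * t) * z ^ gcd d ?n" by (simp add: power_add)
    then have g: "z ^ gcd d ?n = 1" using \<open>z ^ d = 1\<close> zn by (simp add: power_mult)
    have "gcd d ?n < ?n" using d by (metis gcd_le1_nat le_less_trans not_gr_zero)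
    then obtain p where "p \<in> A" "gcd d ?n dvd \<Prod>(A - {p})" using dvd_remove by auto
    then have "z ^ \<Prod>(A - {p}) = 1" using g by (auto simp: power_mult elim!: dvdE)
    then show False using \<open>p \<in> A\<close> assms(4) by (auto simp: prim_roots_def)
  qed
  have z0: "z \<noteq> 0" using zn n by (metis power_0_left zero_neq_one less_irrefl)
  have inj: "inj_on (\<lambda>i. z ^ i) {1..?n}"
  proof (rule linorder_inj_onI)
    fix i j assume ij: "i < j" "i \<in> {1..?n}" "j \<in> {1..?n}"
    show "z ^ i \<noteq> z ^ j"
    proof
      assume "z ^ i = z ^ j"
      moreover have "z ^ j = z ^ i * z ^ (j - i)" using ij by (simp flip: power_add)
      ultimately have "z ^ (j - i) = 1" using z0 by simp
      moreover have "0 < j - i" "j - i < ?n" using ij by (simp, simp only: atLeastAtMost_iff, linarith)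
      ultimately show False using order by blast
    qed
  qed auto
  have "(\<lambda>i. z ^ i) ` {1..?n} = {w. w ^ ?n = 1}"
  proof (rule card_seteq)
    show "finite {w::complex. w ^ ?n = 1}" using finite_nth_roots n by blast
    show "(\<lambda>i. z ^ i) ` {1..?n} \<subseteq> {w. w ^ ?n = 1}"
      using zn by (auto simp: power_mult[symmetric]) (metis mult.commute power_mult power_one)
    show "card {w::complex. w ^ ?n = 1} \<le> card ((\<lambda>i. z ^ i) ` {1..?n})"
      unfolding card_image[OF inj] using card_nth_roots[of 1 ?n] n by simp
  qed
  then obtain a where a: "a \<in> {1..?n}" "y = z ^ a" using zn by blast
  have "coprime a ?n"
  proof (rule ccontr)
    assume "\<not> coprime a ?n"
    then have "gcd a ?n \<noteq> 1" by (simp add: coprime_iff_gcd_eq_1)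
    then obtain p where "prime p" "p dvd gcd a ?n" using prime_factor_nat by blast
    then have p: "prime p" "p dvd a" "p dvd ?n" by simp_all
    then obtain q where "q \<in> A" "p dvd q" using prime_dvd_prod_iff[OF assms(1) p(1)] by auto
    then have "p \<in> A" using assms(2) p(1) primes_dvd_imp_eq by blast
    obtain b where b: "a = p * b" using p by auto
    have "y ^ \<Prod>(A - {p}) = z ^ (p * \<Prod>(A - {p}) * b)"
      by (simp add: a b power_mult[symmetric] mult_ac)
    also have "p * \<Prod>(A - {p}) = ?n"
      using prod.remove[OF assms(1) \<open>p \<in> A\<close>, of "\<lambda>x. x"] by simp
    finally have "y ^ \<Prod>(A - {p}) = 1" using zn by (simp add: power_mult)
    then show False using \<open>p \<in> A\<close> assms(5) by (auto simp: prim_roots_def)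
  qed
  then show ?thesis using that[of a] a by auto
qed

text \<open>\<open>G\<close> divides \<open>P\<close> because of the common root, and it vanishes at
  all conjugates of \<open>z\<close>, that is, on all of \<open>prim_roots A\<close>; so its degree
  is that of \<open>P\<close>.\<close>

lemma irreducible_with_prim_root:
  fixes G P :: "int poly"
  assumes A: "finite A" "\<forall>p\<in>A. prime p" "A \<noteq> {}"
    and P: "lead_coeff P = 1" "int_to_cpx_poly P = cyclo A"
    and G: "Polynomial.content G = 1" "irreducible (int_to_rat_poly G)"
    and z: "z \<in> prim_roots A" "poly (int_to_cpx_poly G) z = 0"
  shows "G = P \<or> G = - P"
proof -
  let ?n = "\<Prod>A"
  have n: "?n > 0" using prod_primes_pos A by blast
  have fin: "finite (prim_roots A)" using finite_prim_roots A(2) by blast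
  have zn: "z ^ ?n = 1" using z by (auto simp: prim_roots_def)
  have "poly (int_to_cpx_poly P) z = 0" unfolding P(2) cyclo_def using z fin by (auto simp: poly_prod)
  then have "G dvd P" using irreducible_int_dvd_if_common_root[OF G] z(2) by blast
  then obtain Q where Q: "P = G * Q" by auto
  then have "lead_coeff G dvd 1" using P(1) by (metis dvd_triv_left lead_coeff_mult)
  \<comment> \<open>The results on powers of roots require a monic polynomial; the sign
    \<open>e\<close> normalises \<open>G\<close>.\<close>
  define e where "e = lead_coeff G"
  have e: "e = 1 \<or> e = -1" "e * e = 1" using \<open>lead_coeff G dvd 1\<close> by (auto simp: e_def zdvd1_eq abs_if split: if_splits)
  have "e \<noteq> 0" using e by auto
  define G' where "G' = smult e G"
  have G': "lead_coeff G' = 1" using e(2) \<open>e \<noteq> 0\<close> by (simp add: G'_def e_def[symmetric])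
  have "int_to_rat_poly G' = smult (of_int e) (int_to_rat_poly G)" by (simp add: G'_def)
  then have irr: "irreducible (int_to_rat_poly G')"
    using G(2) e(1) irreducible_mult_unit_left[of "[:of_int e:]" "int_to_rat_poly G"] 
    by (auto simp: is_unit_const_poly_iff)
  have zG': "poly (int_to_cpx_poly G') z = 0" using z by (simp add: G'_def)
  have "cyclo A dvd int_to_cpx_poly G'"
    unfolding cyclo_def
  proof (rule prod_linear_factors_dvd[OF fin])
    fix y assume "y \<in> prim_roots A"
    then obtain a where "a > 0" "coprime a ?n" "y = z ^ a"
      using prim_roots_conjugate[OF A z(1)] by metis
    then show "poly (int_to_cpx_poly G') y = 0"
      using root_power_coprime[OF G' irr zG' zn n] by simp
  qed
  moreover have "degree (int_to_cpx_poly G') \<le> degree (cyclo A)"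
  proof -
    have "P \<noteq> 0" using P(1) by auto
    have "degree G \<le> degree P"
      using dvd_imp_degree_le[OF \<open>G dvd P\<close> \<open>P \<noteq> 0\<close>] .
    then show ?thesis using \<open>e \<noteq> 0\<close> by (auto simp flip: P(2) simp: G'_def)
  qed
  moreover have "lead_coeff (int_to_cpx_poly G') = 1" using G' by simp
  moreover have "lead_coeff (cyclo A) = 1" unfolding cyclo_def by (rule lead_coeff_prod_linear)
  ultimately have "cyclo A = int_to_cpx_poly G'" using monic_dvd_degree_eq by blast
  then have "P = G'" by (simp flip: P(2))
  then show ?thesis using e by (auto simp: G'_def)
qed

section \<open>The sparse polynomial and its two irreducible factors\<close>

lemma int_to_cpx_poly_of_nat [simp]: "int_to_cpx_poly (of_nat k) = of_nat k"
  by (induction k) auto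

lemma pderiv_sum: "pderiv (\<Sum>i\<in>I. f i) = (\<Sum>i\<in>I. pderiv (f i :: 'a::idom poly))"
  by (induction I rule: infinite_finite_induct) (auto simp: pderiv_add)

lemma supp_eq: "supp P = {j. coeff P j \<noteq> 0}"
  unfolding supp_def using le_degree by auto

lemma supp_int_to_rat_poly [simp]: "supp (int_to_rat_poly P) = supp P"
  by (simp add: supp_eq)

lemma supp_smult [simp]: "c \<noteq> 0 \<Longrightarrow> supp (smult c P) = supp (P :: 'a::idom poly)"
  by (simp add: supp_eq)

lemma supp_uminus [simp]: "supp (- P) = supp (P :: 'a::idom poly)"
  by (simp add: supp_eq)

lemma complex_poly_norm_linear_factors:
  fixes P :: "complex poly"
  obtains root where "\<And>z. norm (poly P z) = norm (lead_coeff P) * (\<Prod>i<degree P. norm (z - root i))"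
    "\<And>i. i < degree P \<Longrightarrow> poly P (root i) = 0"
proof (cases "P = 0")
  case True
  then show ?thesis using that[of undefined] by auto
next
  case False
  obtain root where root: "smult (lead_coeff P) (\<Prod>i<degree P. [:- root i, 1:]) = P"
    using complex_poly_decompose' by blast
  have eval: "poly P z = lead_coeff P * (\<Prod>i<degree P. z - root i)" for z
    by (subst root[symmetric]) (simp add: poly_prod)
  show ?thesis
  proof (rule that[of root])
    show "norm (poly P z) = norm (lead_coeff P) * (\<Prod>i<degree P. norm (z - root i))" for z
      unfolding eval by (simp add: norm_mult prod_norm)
    show "poly P (root i) = 0" if "i < degree P" for i
      unfolding eval using that by auto
  qed
qed

text \<open>By Vieta, |P(0)| is the modulus of the leading coefficient, at least 1, times the
  product of the moduli of the roots.\<close>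

lemma int_poly_coeff_0_gt_1:
  fixes P :: "int poly"
  assumes "degree P > 0" "\<And>z. poly (int_to_cpx_poly P) z = 0 \<Longrightarrow> norm z > 1"
  shows "\<bar>coeff P 0\<bar> > 1"
proof -
  obtain root where root: "\<And>z. norm (poly (int_to_cpx_poly P) z) = norm (lead_coeff (int_to_cpx_poly P)) *
        (\<Prod>i<degree P. norm (z - root i))"
    "\<And>i. i < degree P \<Longrightarrow> poly (int_to_cpx_poly P) (root i) = 0"
    using complex_poly_norm_linear_factors[of "int_to_cpx_poly P"] by auto
  have "lead_coeff P \<noteq> 0" using assms(1) by auto
  then have "\<bar>lead_coeff P\<bar> \<ge> 1" by linarith
  then have 1: "norm (lead_coeff (int_to_cpx_poly P)) \<ge> 1" by simp
  have "(\<Prod>i<degree P. norm (0 - root i)) > (\<Prod>i<degree P. 1)"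
    using root(2) assms by (intro prod_mono_strict) (fastforce intro: less_imp_le)+
  then have "norm (poly (int_to_cpx_poly P) 0) > 1"
    unfolding root(1) using 1 by (smt (verit) mult_le_cancel_right1 prod.neutral_const)
  then have "norm (of_int (coeff P 0) :: complex) > 1" by (simp add: poly_0_coeff_0)
  then show ?thesis by simp
qed

text \<open>For x >= 1, a root in the closed disc is at least as far from x as from 1. So |P(x)| >=
  |P(1)|, and P(1) is a nonzero integer. Applied to a cofactor, this bounds a factor by the whole
  product on [1, oo).\<close>

lemma norm_int_poly_ge_1:
  fixes P :: "int poly" and x :: real
  assumes "\<And>z. poly (int_to_cpx_poly P) z = 0 \<Longrightarrow> norm z \<le> 1"
    and "poly (int_to_cpx_poly P) 1 \<noteq> 0" and "x \<ge> 1"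
  shows "norm (poly (int_to_cpx_poly P) (of_real x)) \<ge> 1"
proof -
  obtain root where root: "\<And>z. norm (poly (int_to_cpx_poly P) z) = norm (lead_coeff (int_to_cpx_poly P)) *
        (\<Prod>i<degree P. norm (z - root i))"
    "\<And>i. i < degree P \<Longrightarrow> poly (int_to_cpx_poly P) (root i) = 0"
    using complex_poly_norm_linear_factors[of "int_to_cpx_poly P"] by auto
  have "norm (1 - root i) \<le> norm (of_real x - root i)" if "i < degree P" for i
  proof -
    have "norm (root i) \<le> 1" using root(2) assms(1) that by blast
    then have "Re (root i) \<le> 1" using complex_Re_le_cmod order_trans by blast
    then have "(x - 1) * (x + 1 - 2 * Re (root i)) \<ge> 0" using assms(3) by (intro mult_nonneg_nonneg) auto
    then show ?thesis unfolding cmod_def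
      by (intro real_sqrt_le_mono) (simp add: power2_eq_square algebra_simps)
  qed
  then have "norm (poly (int_to_cpx_poly P) 1) \<le> norm (poly (int_to_cpx_poly P) (of_real x))"
    unfolding root(1) by (intro mult_left_mono prod_mono) auto
  moreover have "poly (int_to_cpx_poly P) 1 = of_int (poly P 1)"
    by (simp add: poly_altdef)
  moreover from this assms(2) have "\<bar>poly P 1\<bar> \<ge> 1" by auto
  ultimately show ?thesis by (simp add: norm_of_int)
qed

text \<open>The real part is (1 - Re w) / |1 - w|^2, and |1 - w|^2 <= 2 (1 - Re w) whenever |w| <=
  1.\<close>

lemma Re_inverse_one_minus:
  fixes w :: complex
  assumes "norm w \<le> 1" "w \<noteq> 1"
  shows "Re (1 / (1 - w)) \<ge> 1 / 2"
proof -
  have "(Re w)\<^sup>2 + (Im w)\<^sup>2 \<le> 1"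
    using assms(1) by (metis abs_norm_cancel abs_square_le_1 cmod_power2)
  moreover have "(1 - Re w)\<^sup>2 + (Im w)\<^sup>2 > 0"
    using assms(2) by (metis complex_eq_iff eq_iff_diff_eq_0 minus_complex.simps one_complex.simps
        sum_power2_gt_zero_iff)
  ultimately show ?thesis
    by (simp add: Re_divide field_simps power2_eq_square)
qed

lemma sum_powers_telescope:
  fixes y :: "'a::comm_ring_1"
  shows "(\<Sum>j=1..r. y ^ j) - of_nat r * y ^ (r + 1) = (1 - y) * (\<Sum>j=1..r. of_nat j * y ^ j)"
  by (induction r) (auto simp: algebra_simps)

text \<open>Two demands on the sum of the weights: it is prime, for the sake of H(0), and it exceeds
  r (r + 1), because Re W is at least half this sum minus 1 + ... + r.\<close>

locale sparse_construction =
  fixes A :: "nat set" and c :: "nat \<Rightarrow> int" and r :: nat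
  assumes A: "finite A" "\<forall>p\<in>A. prime p" "A \<noteq> {}"
    and c: "\<And>p. p \<in> A \<Longrightarrow> c p > 0"
    and r: "r > 0"
    and ell: "prime (\<Sum>p\<in>A. c p)" "(\<Sum>p\<in>A. c p) > int r * (int r + 1)"
begin

abbreviation n :: nat where "n \<equiv> \<Prod>A"
abbreviation co :: "nat \<Rightarrow> nat" where "co p \<equiv> \<Prod>(A - {p})"

definition Psi :: "nat \<Rightarrow> int poly" where
  "Psi p = (\<Sum>j<p. monom 1 (j * co p))"

text \<open>Since \<open>Tail = (1 - x\<^sup>n) (x\<^sup>n + 2 x\<^sup>2\<^sup>n + \<dots> + r x\<^sup>r\<^sup>n)\<close>, it adds an arbitrary number of terms to \<open>F\<close>
  and only perturbs the factor \<open>W\<close> below.\<close>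

definition Tail :: "int poly" where
  "Tail = (\<Sum>j=1..r. monom 1 (j * n)) - monom (int r) ((r + 1) * n)"

definition F :: "int poly" where
  "F = (\<Sum>p\<in>A. smult (c p) (Psi p)) + Tail"

definition W :: "complex \<Rightarrow> complex" where
  "W z = (\<Sum>p\<in>A. of_int (c p) / (1 - z ^ co p)) + (\<Sum>j=1..r. of_nat j * z ^ (j * n))"

lemma n_pos: "n > 0" using prod_primes_pos A by blast

lemma co_pos: "co p > 0" using prod_primes_pos[of "A - {p}"] A by blast

lemma n_ne_0: "n \<noteq> 0" and co_ne_0: "co p \<noteq> 0"
  using n_pos co_pos[of p] by (simp_all only: neq0_conv)

lemma n_eq: "p \<in> A \<Longrightarrow> n = p * co p"
  using prod.remove[OF A(1), of p "\<lambda>x. x"] by simp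

lemma prime_A: "p \<in> A \<Longrightarrow> prime p" using A by blast

lemma Psi_mult:
  assumes "p \<in> A"
  shows "Psi p * (1 - monom 1 (co p)) = 1 - monom 1 n"
proof -
  have "Psi p = (\<Sum>j<p. monom 1 (co p) ^ j)"
    by (simp add: Psi_def monom_power mult.commute)
  then have "Psi p * (1 - monom 1 (co p)) = 1 - monom 1 (co p) ^ p"
    by (simp add: one_diff_power_eq mult.commute)
  then show ?thesis using n_eq[OF assms] by (simp add: monom_power mult.commute)
qed

lemma Tail_mult: "Tail = (1 - monom 1 n) * (\<Sum>j=1..r. of_nat j * monom 1 n ^ j)"
  unfolding sum_powers_telescope[symmetric]
  by (simp add: Tail_def monom_power of_nat_poly smult_monom mult_monom mult.commute distrib_left)

lemma cpx_Psi_mult: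
  assumes "p \<in> A"
  shows "poly (int_to_cpx_poly (Psi p)) z * (1 - z ^ co p) = 1 - z ^ n"
  using arg_cong[OF Psi_mult[OF assms], of "\<lambda>P. poly (int_to_cpx_poly P) z"]
  by (simp add: poly_monom)

lemma cpx_Tail: "poly (int_to_cpx_poly Tail) z = (1 - z ^ n) * (\<Sum>j=1..r. of_nat j * z ^ (j * n))"
  unfolding Tail_mult by (simp add: poly_monom poly_sum poly_power power_mult[symmetric] mult.commute)

lemma F_eq_W:
  assumes "\<And>p. p \<in> A \<Longrightarrow> z ^ co p \<noteq> 1"
  shows "poly (int_to_cpx_poly F) z = (1 - z ^ n) * W z"
proof -
  have "poly (int_to_cpx_poly (Psi p)) z = (1 - z ^ n) / (1 - z ^ co p)" if "p \<in> A" for p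
    using cpx_Psi_mult[OF that, of z] assms[OF that] by (simp add: field_simps)
  then show ?thesis
    by (simp add: F_def poly_sum cpx_Tail W_def algebra_simps sum_distrib_left)
qed

lemma W_nonzero:
  assumes "\<And>p. p \<in> A \<Longrightarrow> z ^ co p \<noteq> 1" "norm z \<le> 1"
  shows "W z \<noteq> 0"
proof -
  have zn: "norm (z ^ k) \<le> 1" for k using assms(2) by (simp add: norm_power power_le_one)
  have "Re (of_int (c p) / (1 - z ^ co p)) \<ge> of_int (c p) / 2" if "p \<in> A" for p
  proof -
    have "Re (of_int (c p) / (1 - z ^ co p)) = of_int (c p) * Re (1 / (1 - z ^ co p))"
      by (simp add: Re_divide)
    also have "\<dots> \<ge> of_int (c p) * (1 / 2)"
      using Re_inverse_one_minus[OF zn assms(1)[OF that]] c[OF that] by (intro mult_left_mono) auto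
    finally show ?thesis by simp
  qed
  then have 1: "Re (\<Sum>p\<in>A. of_int (c p) / (1 - z ^ co p)) \<ge> (\<Sum>p\<in>A. of_int (c p) / 2)"
    unfolding Re_sum by (intro sum_mono)
  have "Re (of_nat j * z ^ (j * n)) \<ge> - real j" for j
  proof -
    have "norm (of_nat j * z ^ (j * n)) \<le> real j"
      using zn[of "j * n"] by (simp add: norm_mult mult_left_le)
    then show ?thesis using abs_Re_le_cmod[of "of_nat j * z ^ (j * n)"] by linarith
  qed
  then have 2: "Re (\<Sum>j=1..r. of_nat j * z ^ (j * n)) \<ge> (\<Sum>j=1..r. - real j)"
    unfolding Re_sum by (intro sum_mono)
  have "(\<Sum>j=1..r. - real j) = - (real r * (real r + 1) / 2)"
    by (induction r) (auto simp: field_simps)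
  moreover have "(\<Sum>p\<in>A. of_int (c p) / 2) > real r * (real r + 1) / 2"
  proof -
    have "real_of_int (\<Sum>p\<in>A. c p) > real_of_int (int r * (int r + 1))"
      using ell(2) by (simp only: of_int_less_iff)
    then show ?thesis by (simp add: sum_divide_distrib[symmetric])
  qed
  ultimately have "Re (W z) > 0" using 1 2 unfolding W_def by simp
  then show ?thesis by auto
qed

text \<open>If z^n is not 1, then F(z) = (1 - z^n) W(z) is nonzero. If z^n = 1, the tail vanishes
  and each \<open>Psi p\<close> takes the value p or 0; with positive weights nothing cancels, so
  F(z) = 0 forces every value to be 0.\<close>

lemma root_in_disc:
  assumes "poly (int_to_cpx_poly F) z = 0" "norm z \<le> 1"
  shows "z \<in> prim_roots A"
proof (cases "z ^ n = 1")
  case False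
  then have "z ^ co p \<noteq> 1" if "p \<in> A" for p using n_eq[OF that] 
    by (metis mult.commute power_mult power_one)
  then show ?thesis using F_eq_W W_nonzero assms False by auto
next
  case True
  have Psi_val: "poly (int_to_cpx_poly (Psi p)) z = (if z ^ co p = 1 then of_nat p else 0)" if "p \<in> A" for p
  proof (cases "z ^ co p = 1")
    case True
    then have "z ^ (j * co p) = 1" for j by (metis mult.commute power_mult power_one)
    then show ?thesis using True by (simp add: Psi_def poly_sum poly_monom)
  next
    case False
    then show ?thesis using cpx_Psi_mult[OF that, of z] True by auto
  qed
  have "poly (int_to_cpx_poly F) z = (\<Sum>p\<in>A. of_int (c p) * (if z ^ co p = 1 then of_nat p else 0))"
    by (simp add: F_def poly_sum cpx_Tail True Psi_val cong: sum.cong)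
  also have "\<dots> = of_int (\<Sum>p\<in>A. c p * (if z ^ co p = 1 then int p else 0))"
    unfolding of_int_sum by (intro sum.cong) auto
  finally have "(\<Sum>p\<in>A. c p * (if z ^ co p = 1 then int p else 0)) = 0"
    using assms(1) of_int_eq_0_iff[THEN iffD1, OF sym[OF trans[OF sym[OF assms(1)]]]] by blast
  then have "\<forall>p\<in>A. c p * (if z ^ co p = 1 then int p else 0) = 0"
    using A(1) c by (subst (asm) sum_nonneg_eq_0_iff) (auto simp: order_less_imp_le)
  then have "z ^ co p \<noteq> 1" if "p \<in> A" for p
    using that c[OF that] prime_gt_0_nat[OF prime_A[OF that]] by (auto split: if_splits)
  then show ?thesis using True by (auto simp: prim_roots_def)
qed

text \<open>Since F = (1 - x^n) W and z^n = 1, the derivative at \<open>z\<close> is - n z^(n-1)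
  W(z). As \<open>W\<close> is not a polynomial, this is computed summand by summand.\<close>

lemma prim_root_simple:
  assumes "z \<in> prim_roots A"
  shows "poly (int_to_cpx_poly F) z = 0" "poly (pderiv (int_to_cpx_poly F)) z \<noteq> 0"
proof -
  have zn: "z ^ n = 1" and zp: "\<And>p. p \<in> A \<Longrightarrow> z ^ co p \<noteq> 1"
    using assms by (auto simp: prim_roots_def)
  show "poly (int_to_cpx_poly F) z = 0" using F_eq_W[OF zp] zn by simp
  have "norm z = 1" using norm_prim_roots A assms by blast
  then have "z \<noteq> 0" by auto
  have d: "poly (pderiv (1 - monom 1 n)) z = - (of_nat n * z ^ (n - 1))"
    by (simp add: pderiv_diff pderiv_monom poly_monom)
  have Psi': "poly (pderiv (int_to_cpx_poly (Psi p))) z = - (of_nat n * z ^ (n - 1)) / (1 - z ^ co p)"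
    if "p \<in> A" for p
  proof -
    have "int_to_cpx_poly (Psi p) * (1 - monom 1 (co p)) = 1 - monom 1 n"
      using arg_cong[OF Psi_mult[OF that], of int_to_cpx_poly] by simp
    then have "poly (pderiv (int_to_cpx_poly (Psi p) * (1 - monom 1 (co p)))) z = - (of_nat n * z ^ (n - 1))"
      using d by simp
    moreover have "poly (int_to_cpx_poly (Psi p)) z = 0"
      using cpx_Psi_mult[OF that, of z] zn zp[OF that] by simp
    ultimately have "poly (pderiv (int_to_cpx_poly (Psi p))) z * (1 - z ^ co p) = - (of_nat n * z ^ (n - 1))"
      by (simp add: pderiv_mult poly_monom mult.commute)
    then show ?thesis using zp[OF that] by (metis eq_iff_diff_eq_0 nonzero_eq_divide_eq)
  qed
  have Tail': "poly (pderiv (int_to_cpx_poly Tail)) z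
      = - (of_nat n * z ^ (n - 1)) * (\<Sum>j=1..r. of_nat j * z ^ (j * n))"
  proof -
    define S where "S = int_to_cpx_poly (\<Sum>j=1..r. of_nat j * monom 1 n ^ j)"
    have "int_to_cpx_poly Tail = (1 - monom 1 n) * S"
      unfolding S_def Tail_mult by simp
    moreover have "poly S z = (\<Sum>j=1..r. of_nat j * z ^ (j * n))"
      unfolding S_def by (simp add: poly_monom poly_sum poly_power power_mult[symmetric] mult.commute)
    ultimately show ?thesis using d zn by (simp add: pderiv_mult poly_monom)
  qed
  define K where "K = - (of_nat n * z ^ (n - 1))"
  have "poly (pderiv (int_to_cpx_poly F)) z
      = (\<Sum>p\<in>A. of_int (c p) * poly (pderiv (int_to_cpx_poly (Psi p))) z)
        + poly (pderiv (int_to_cpx_poly Tail)) z"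
    by (simp add: F_def pderiv_add pderiv_sum pderiv_smult poly_sum)
  also have "(\<Sum>p\<in>A. of_int (c p) * poly (pderiv (int_to_cpx_poly (Psi p))) z)
      = (\<Sum>p\<in>A. K * (of_int (c p) / (1 - z ^ co p)))"
    by (intro sum.cong refl) (simp only: Psi' K_def, simp)
  also have "\<dots> + poly (pderiv (int_to_cpx_poly Tail)) z = K * W z"
    unfolding Tail' W_def K_def[symmetric] sum_distrib_left[symmetric] by (simp only: distrib_left)
  finally have "poly (pderiv (int_to_cpx_poly F)) z = - (of_nat n * z ^ (n - 1)) * W z"
    by (simp only: K_def)
  then show "poly (pderiv (int_to_cpx_poly F)) z \<noteq> 0"
    using W_nonzero[OF zp] \<open>norm z = 1\<close> \<open>z \<noteq> 0\<close> n_pos by (simp del: of_nat_prod)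
qed

text \<open>A root of \<open>H\<close> in the closed disc would lie in \<open>prim_roots A\<close>,
  hence be a root of \<open>P\<close> as well and a multiple root of \<open>F\<close>. The roots of
  \<open>P\<close> have modulus 1, so |P(0)| = 1 and |H(0)| = F(0), to which the tail contributes
  nothing.\<close>

lemma cofactors:
  obtains P H :: "int poly" where "lead_coeff P = 1" "int_to_cpx_poly P = cyclo A" "F = P * H"
    "\<And>z. poly (int_to_cpx_poly P) z = 0 \<longleftrightarrow> z \<in> prim_roots A"
    "\<And>z. poly (int_to_cpx_poly H) z = 0 \<Longrightarrow> norm z > 1"
    "\<bar>coeff H 0\<bar> = (\<Sum>p\<in>A. c p)"
proof -
  obtain P :: "int poly" where P: "lead_coeff P = 1" "int_to_cpx_poly P = cyclo A"
    using cyclo_int A by metis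
  have fin: "finite (prim_roots A)" using finite_prim_roots A by blast
  have "cyclo A dvd int_to_cpx_poly F"
    unfolding cyclo_def using fin prim_root_simple(1) by (rule prod_linear_factors_dvd)
  then obtain Q where "int_to_cpx_poly F = int_to_cpx_poly P * Q" unfolding P(2) by auto
  then obtain H where H: "F = P * H" using int_monic_dvd_complex[OF P(1)] by metis
  have Pz: "poly (int_to_cpx_poly P) z = 0 \<longleftrightarrow> z \<in> prim_roots A" for z
    using fin by (auto simp: P(2) cyclo_def poly_prod)
  have Hz: "norm z > 1" if "poly (int_to_cpx_poly H) z = 0" for z
  proof (rule ccontr)
    assume "\<not> norm z > 1"
    then have z: "z \<in> prim_roots A" using that by (intro root_in_disc) (auto simp: H)
    then have "poly (pderiv (int_to_cpx_poly F)) z = 0"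
      using that Pz by (simp add: H pderiv_mult)
    then show False using prim_root_simple(2) z by blast
  qed
  have F0: "coeff F 0 = (\<Sum>p\<in>A. c p)"
  proof -
    have "poly (Psi p) 0 = 1" if "p \<in> A" for p
    proof -
      have "poly (Psi p * (1 - monom 1 (co p))) 0 = poly (1 - monom 1 n) 0"
        by (simp only: Psi_mult[OF that])
      then show ?thesis using n_ne_0 co_ne_0[of p]
        by (simp add: poly_monom power_0_left del: prod_zero_iff)
    qed
    moreover have "poly Tail 0 = 0"
      using n_pos unfolding Tail_mult by (auto simp: poly_sum poly_monom poly_power power_0_left)
    ultimately have "poly F 0 = (\<Sum>p\<in>A. c p)" by (simp add: F_def poly_sum)
    then show ?thesis by (simp add: poly_0_coeff_0)
  qed
  have "norm (poly (int_to_cpx_poly P) 0) = (\<Prod>z\<in>prim_roots A. norm z)"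
    by (simp add: P(2) cyclo_def poly_prod flip: prod_norm)
  also have "\<dots> = 1" using norm_prim_roots A by (intro prod.neutral) blast
  finally have "norm (of_int (coeff P 0) :: complex) = 1" by (simp add: poly_0_coeff_0)
  then have "\<bar>coeff P 0\<bar> = 1" by simp
  moreover have "coeff F 0 = coeff P 0 * coeff H 0" by (simp add: H coeff_mult)
  ultimately have "\<bar>coeff H 0\<bar> = (\<Sum>p\<in>A. c p)"
    using F0 ell(1) prime_gt_0_int[OF ell(1)] by (metis abs_mult abs_of_pos mult_1)
  then show ?thesis using that P H Pz Hz by blast
qed

text \<open>A factor with a root in the closed unit disc is cyclotomic. Any other factor divides \<open>H\<close>,
  which is irreducible because \<open>H(0)\<close> is prime and all its roots lie outside the disc.\<close>

lemma supp_irreducible_factor: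
  fixes G :: "rat poly"
  assumes P: "lead_coeff P = 1" "int_to_cpx_poly P = cyclo A" "F = P * H"
    and Pz: "\<And>z. poly (int_to_cpx_poly P) z = 0 \<longleftrightarrow> z \<in> prim_roots A"
    and Hz: "\<And>z. poly (int_to_cpx_poly H) z = 0 \<Longrightarrow> norm z > 1"
    and H0: "\<bar>coeff H 0\<bar> = (\<Sum>p\<in>A. c p)"
    and G: "irreducible G" "G dvd int_to_rat_poly F"
  shows "supp G = supp P \<or> supp G = supp H"
proof -
  have "G \<noteq> 0" using G(1) by auto
  then obtain a K where K: "a \<noteq> 0" "G = smult a (int_to_rat_poly K)" "Polynomial.content K = 1"
    by (rule rat_poly_primitive_int)
  have supp: "supp G = supp K" using K by simp
  have irr: "irreducible (int_to_rat_poly K)"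
    using G(1) irreducible_mult_unit_left[of "[:a:]" "int_to_rat_poly K"] K
    by (auto simp: is_unit_const_poly_iff dvd_field_iff)
  have "int_to_rat_poly K dvd int_to_rat_poly F" using G(2) K by (simp add: smult_dvd_iff)
  show ?thesis
  proof (cases "\<exists>z\<in>prim_roots A. poly (int_to_cpx_poly K) z = 0")
    case True
    then have "K = P \<or> K = - P" using irreducible_with_prim_root[OF A P(1,2) K(3) irr] by blast
    then show ?thesis by (metis supp supp_uminus)
  next
    case False
    have deg: "degree K > 0"
    proof (rule ccontr)
      assume "\<not> degree K > 0"
      then obtain k where k: "K = [:k:]" using degree_eq_zeroE by blast
      then have "k \<noteq> 0" using irr by auto
      then have "int_to_rat_poly K dvd 1" using k
        by (simp add: int_to_rat_poly_def map_poly_pCons is_unit_const_poly_iff dvd_field_iff)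
      then show False using irr by (simp add: irreducible_def)
    qed
    have "prime_elem (int_to_rat_poly K)" using field_poly_irreducible_imp_prime irr by blast
    moreover have "\<not> int_to_rat_poly K dvd int_to_rat_poly P"
    proof
      assume "int_to_rat_poly K dvd int_to_rat_poly P"
      then have "K dvd P" using gauss_int_dvd K(3) by blast
      then obtain R where R: "P = K * R" by auto
      obtain z where "poly (int_to_cpx_poly K) z = 0"
        using fundamental_theorem_of_algebra constant_degree deg
        by (metis degree_int_to_cpx_poly less_irrefl)
      moreover from this have "z \<in> prim_roots A" unfolding Pz[symmetric] R by simp
      ultimately show False using False by blast
    qed
    ultimately have "int_to_rat_poly K dvd int_to_rat_poly H"
      using \<open>int_to_rat_poly K dvd int_to_rat_poly F\<close> unfolding P(3)
      by (simp add: prime_elem_dvd_mult_iff)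
    then have "K dvd H" using gauss_int_dvd K(3) by blast
    then obtain R where R: "H = K * R" by auto
    have "\<bar>coeff K 0\<bar> > 1"
      using Hz deg by (intro int_poly_coeff_0_gt_1) (auto simp: R)
    moreover have "prime (\<bar>coeff K 0\<bar> * \<bar>coeff R 0\<bar>)"
      using H0 ell(1) by (simp add: R coeff_mult abs_mult)
    ultimately have "\<bar>coeff R 0\<bar> = 1"
      by (metis prime_imp_prime_elem prime_elem_imp_irreducible irreducibleD zdvd1_eq abs_abs less_irrefl)
    \<comment> \<open>A nonconstant \<open>R\<close> would have |R(0)| > 1, because its roots are
      roots of \<open>H\<close>.\<close>
    then have "degree R = 0"
      using Hz int_poly_coeff_0_gt_1[of R] by (auto simp: R)
    then obtain k where k: "R = [:k:]" using degree_eq_zeroE by blast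
    with \<open>\<bar>coeff R 0\<bar> = 1\<close> have "k \<noteq> 0" by auto
    then have "supp H = supp K" by (simp add: R k)
    then show ?thesis using supp by simp
  qed
qed

section \<open>Counting the terms of \<open>F\<close>\<close>

lemma coeff_Psi: "coeff (Psi p) i = (if \<exists>j<p. i = j * co p then 1 else 0)"
proof -
  have "coeff (Psi p) i = (\<Sum>j<p. if j * co p = i then 1 else 0)"
    by (simp add: Psi_def coeff_sum)
  also have "\<dots> = int (card {j\<in>{..<p}. j * co p = i})"
    by (simp add: sum.If_cases Int_def)
  also have "{j\<in>{..<p}. j * co p = i} = (if \<exists>j<p. i = j * co p then {i div co p} else {})"
    using co_pos[of p] by auto
  finally show ?thesis by simp
qed

lemma coeff_Tail: "coeff Tail i = (if \<exists>j\<in>{1..r}. i = j * n then 1 else 0)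
    - (if i = (r + 1) * n then int r else 0)"
proof -
  have "(\<Sum>j=1..r. coeff (monom 1 (j * n)) i) = (\<Sum>j=1..r. if j * n = i then 1 else (0::int))"
    by (intro sum.cong) auto
  also have "\<dots> = int (card {j\<in>{1..r}. j * n = i})"
    by (simp add: sum.If_cases Int_def)
  also have "{j\<in>{1..r}. j * n = i} = (if \<exists>j\<in>{1..r}. i = j * n then {i div n} else {})"
    using n_pos by auto
  finally show ?thesis by (simp add: Tail_def coeff_sum)
qed

text \<open>No cancellation occurs: the \<open>Psi p\<close> have positive weights and live below
  degree \<open>n\<close>, the tail has coefficient 1 at n, ..., r n, and its only negative
  coefficient sits at (r + 1) n, beyond everything else.\<close>

lemma supp_F: "supp F = (\<lambda>j. j * n) ` {0..r + 1} \<union> (\<Union>p\<in>A. (\<lambda>j. j * co p) ` {1..<p})"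
proof -
  have lt: "j * co p < n" if "p \<in> A" "j < p" for j p
    using that n_eq[of p] co_pos[of p] by simp
  have "coeff F i \<noteq> 0 \<longleftrightarrow> (\<exists>p\<in>A. \<exists>j<p. i = j * co p) \<or> (\<exists>j\<in>{1..r + 1}. i = j * n)" for i
  proof (cases "i = (r + 1) * n")
    case True
    have "n \<le> i" using True by simp
    then have "coeff (Psi p) i = 0" if "p \<in> A" for p
      using lt[OF that] unfolding coeff_Psi by (metis not_less)
    moreover have "\<not> (\<exists>j\<in>{1..r}. i = j * n)"
      unfolding True using n_ne_0 by (auto simp del: prod_zero_iff mult_Suc)
    ultimately have "coeff F i = - int r" using True by (simp add: F_def coeff_sum coeff_Tail)
    moreover have "\<exists>j\<in>{1..r + 1}. i = j * n" unfolding True by (intro bexI[of _ "r + 1"]) auto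
    ultimately show ?thesis using r by simp
  next
    case False
    have "coeff F i = (\<Sum>p\<in>A. c p * coeff (Psi p) i) + (if \<exists>j\<in>{1..r}. i = j * n then 1 else 0)"
      using False by (simp add: F_def coeff_sum coeff_Tail)
    moreover have "(\<Sum>p\<in>A. c p * coeff (Psi p) i) \<ge> 0"
      using c by (intro sum_nonneg mult_nonneg_nonneg) (auto simp: coeff_Psi less_imp_le)
    moreover have "(\<Sum>p\<in>A. c p * coeff (Psi p) i) = 0 \<longleftrightarrow> \<not> (\<exists>p\<in>A. \<exists>j<p. i = j * co p)"
    proof -
      have "(\<Sum>p\<in>A. c p * coeff (Psi p) i) = 0 \<longleftrightarrow> (\<forall>p\<in>A. c p * coeff (Psi p) i = 0)"
        using A(1) c by (intro sum_nonneg_eq_0_iff mult_nonneg_nonneg) (auto simp: coeff_Psi less_imp_le)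
      also have "\<dots> \<longleftrightarrow> \<not> (\<exists>p\<in>A. \<exists>j<p. i = j * co p)"
        using c by (force simp: coeff_Psi)
      finally show ?thesis .
    qed
    moreover have "(\<exists>j\<in>{1..r + 1}. i = j * n) \<longleftrightarrow> (\<exists>j\<in>{1..r}. i = j * n)"
    proof -
      have "{1..r + 1} = insert (r + 1) {1..r}" by auto
      then show ?thesis using False by (simp only: bex_simps) blast
    qed
    ultimately show ?thesis by auto
  qed
  then have *: "supp F = {i. (\<exists>p\<in>A. \<exists>j<p. i = j * co p) \<or> (\<exists>j\<in>{1..r + 1}. i = j * n)}"
    by (simp add: supp_eq)
  obtain q where q: "q \<in> A" using A(3) by blast
  have q0: "0 < q" using prime_gt_0_nat[OF prime_A[OF q]] .
  show ?thesis unfolding *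
  proof (intro equalityI subsetI)
    fix i assume "i \<in> {i. (\<exists>p\<in>A. \<exists>j<p. i = j * co p) \<or> (\<exists>j\<in>{1..r + 1}. i = j * n)}"
    then consider p j where "p \<in> A" "j < p" "i = j * co p" | j where "j \<in> {1..r+1}" "i = j * n" by auto
    then show "i \<in> (\<lambda>j. j * n) ` {0..r + 1} \<union> (\<Union>p\<in>A. (\<lambda>j. j * co p) ` {1..<p})"
    proof cases
      case 1
      show ?thesis
      proof (cases "j = 0")
        case True
        then show ?thesis using 1 by (intro UnI1 image_eqI[of _ _ 0]) auto
      next
        case False
        then show ?thesis using 1 by (intro UnI2 UN_I[of p] image_eqI[of _ _ j]) auto
      qed
    qed auto
  next
    fix i assume "i \<in> (\<lambda>j. j * n) ` {0..r + 1} \<union> (\<Union>p\<in>A. (\<lambda>j. j * co p) ` {1..<p})"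
    then consider p j where "p \<in> A" "j < p" "i = j * co p" | j where "j \<in> {1..r+1}" "i = j * n" | "i = 0"
      by (auto simp: Suc_le_eq) (metis mult_is_0 neq0_conv)
    then show "i \<in> {i. (\<exists>p\<in>A. \<exists>j<p. i = j * co p) \<or> (\<exists>j\<in>{1..r + 1}. i = j * n)}"
      using q q0 by cases auto
  qed
qed

text \<open>Exponents i n / p = j n / q give i q = j p, hence p | i, impossible for 0 < i < p. So
  the \<open>Psi p\<close> share only the exponent 0, and \<open>r\<close> remains free to adjust
  the count.\<close>

lemma card_supp_F: "card (supp F) = r + 2 + (\<Sum>p\<in>A. p - 1)"
proof -
  have lt: "j * co p < n" if "p \<in> A" "j < p" for j p
    using that n_eq[of p] co_pos[of p] by simp
  have disj: "(\<lambda>j. j * co p) ` {1..<p} \<inter> (\<lambda>j. j * co q) ` {1..<q} = {}"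
    if pq: "p \<in> A" "q \<in> A" "p \<noteq> q" for p q
  proof (rule ccontr)
    assume "(\<lambda>j. j * co p) ` {1..<p} \<inter> (\<lambda>j. j * co q) ` {1..<q} \<noteq> {}"
    then obtain i j where ij: "1 \<le> i" "i < p" "i * co p = j * co q" by auto
    have "(i * q) * n = q * p * (i * co p)" using n_eq[OF pq(1)] by simp
    also have "\<dots> = (j * p) * n" using n_eq[OF pq(2)] ij(3) by simp
    finally have "i * q = j * p" using n_pos by (simp del: prod_pos_nat_iff)
    then have "p dvd i * q" by simp
    moreover have "\<not> p dvd q" using prime_A pq primes_dvd_imp_eq by blast
    ultimately have "p dvd i" using prime_A[OF pq(1)] by (simp add: prime_dvd_mult_iff)
    then show False using ij by (auto dest: dvd_imp_le)
  qed
  have "card (\<Union>p\<in>A. (\<lambda>j. j * co p) ` {1..<p}) = (\<Sum>p\<in>A. card ((\<lambda>j. j * co p) ` {1..<p}))"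
    using A(1) disj by (intro card_UN_disjoint) auto
  also have "\<dots> = (\<Sum>p\<in>A. p - 1)"
    using co_pos by (intro sum.cong refl) (subst card_image, auto simp: inj_on_def co_ne_0 simp del: prod_zero_iff)
  finally have 1: "card (\<Union>p\<in>A. (\<lambda>j. j * co p) ` {1..<p}) = (\<Sum>p\<in>A. p - 1)" .
  have 2: "card ((\<lambda>j. j * n) ` {0..r + 1}) = r + 2"
    using n_pos by (subst card_image) (auto simp: inj_on_def)
  have "(\<lambda>j. j * n) ` {0..r + 1} \<inter> (\<Union>p\<in>A. (\<lambda>j. j * co p) ` {1..<p}) = {}"
  proof (rule ccontr)
    assume "(\<lambda>j. j * n) ` {0..r + 1} \<inter> (\<Union>p\<in>A. (\<lambda>j. j * co p) ` {1..<p}) \<noteq> {}"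
    then obtain i j p where "p \<in> A" "1 \<le> j" "j < p" "j * co p = i * n" by (auto, metis)
    then have "0 < i * n" "i * n < n" using lt[of p j] co_pos[of p] by auto
    then show False by simp
  qed
  then show ?thesis unfolding supp_F using A(1) 1 2 by (subst card_Un_disjoint) auto
qed

end

section \<open>Values of sparse polynomials near 1\<close>

text \<open>An inequality of Turan type. The operator \<open>f(x) \<mapsto> w\<^sup>-\<^sup>j f(w x) - f(x)\<close> removes the term
  of exponent \<open>j\<close> and shortens the sequence of nodes by one.\<close>

lemma sparse_sum_geometric_nodes:
  fixes a :: "nat \<Rightarrow> real" and w x M :: real
  assumes "finite J" "w \<ge> 1" "M \<ge> 0"
    and "\<And>i. L \<le> i \<Longrightarrow> i < L + card J \<Longrightarrow> \<bar>\<Sum>j\<in>J. a j * (x * w ^ i) ^ j\<bar> \<le> M"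
    and "i \<le> L"
  shows "\<bar>\<Sum>j\<in>J. a j * (x * w ^ i) ^ j\<bar> \<le> M * (2 * real L + 1) ^ card J"
  using assms
proof (induction J arbitrary: a M i)
  case empty
  then show ?case by simp
next
  case (insert l J)
  define f where "f i = (\<Sum>j\<in>insert l J. a j * (x * w ^ i) ^ j)" for i
  define b where "b j = a j * (w ^ j / w ^ l - 1)" for j
  have w: "w > 0" using insert.prems by simp
  have step: "(\<Sum>j\<in>J. b j * (x * w ^ i) ^ j) = f (Suc i) / w ^ l - f i" for i
  proof -
    have "f (Suc i) / w ^ l - f i = (\<Sum>j\<in>insert l J. b j * (x * w ^ i) ^ j)"
      unfolding f_def b_def sum_divide_distrib sum_subtractf[symmetric]
      using w by (intro sum.cong refl) (simp add: field_simps power_mult_distrib)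
    also have "\<dots> = (\<Sum>j\<in>J. b j * (x * w ^ i) ^ j)"
      using insert.hyps w by (simp add: b_def)
    finally show ?thesis by simp
  qed
  have top: "\<bar>f i\<bar> \<le> M" if "L \<le> i" "i < L + Suc (card J)" for i
    using insert.prems(3)[of i] insert.hyps that by (simp add: f_def)
  have wl: "1 \<le> w ^ l" using insert.prems by (simp add: one_le_power)
  have quot: "\<bar>y / w ^ l\<bar> \<le> \<bar>y\<bar>" for y
    using wl w by (simp add: abs_mult field_simps mult_le_cancel_left1)
  have diff: "\<bar>\<Sum>j\<in>J. b j * (x * w ^ i) ^ j\<bar> \<le> 2 * M * (2 * real L + 1) ^ card J" if "i \<le> L" for i
  proof (rule insert.IH)
    fix i assume i: "L \<le> i" "i < L + card J"
    then have "\<bar>f i\<bar> \<le> M" "\<bar>f (Suc i)\<bar> \<le> M" by (auto intro!: top)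
    then show "\<bar>\<Sum>j\<in>J. b j * (x * w ^ i) ^ j\<bar> \<le> 2 * M"
      unfolding step using quot[of "f (Suc i)"] by linarith
  qed (use insert.prems that in auto)
  define K where "K = (2 * real L + 1) ^ card J"
  have K: "K \<ge> 1" by (simp add: K_def one_le_power)
  \<comment> \<open>Walk down from node \<open>L\<close>. As w >= 1, dividing by w^l costs nothing,
    and each step adds at most 2 M K, the bound for the shortened sum. At most \<open>L\<close>
    steps therefore give the factor 2 L + 1.\<close>
  have "\<bar>f (L - d)\<bar> \<le> M + real d * (2 * M * K)" if "d \<le> L" for d
    using that
  proof (induction d)
    case 0
    show ?case using top[of L] by simp
  next
    case (Suc d)
    then have eq: "Suc (L - Suc d) = L - d" by simp
    have "f (L - Suc d) = f (L - d) / w ^ l - (\<Sum>j\<in>J. b j * (x * w ^ (L - Suc d)) ^ j)"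
      unfolding step eq by simp
    then have "\<bar>f (L - Suc d)\<bar> \<le> \<bar>f (L - d)\<bar> + 2 * M * K"
      using quot[of "f (L - d)"] diff[OF diff_le_self, of "Suc d"] unfolding K_def by linarith
    then show ?case using Suc by (simp add: algebra_simps)
  qed
  from this[of "L - i"] insert.prems(4) have "\<bar>f i\<bar> \<le> M + real (L - i) * (2 * M * K)" by simp
  also have "\<dots> \<le> M * K + real L * (2 * M * K)"
    using K insert.prems(2) by (intro add_mono mult_right_mono) (auto simp: mult_le_cancel_left1)
  also have "\<dots> = M * (2 * real L + 1) ^ card (insert l J)"
    using insert.hyps by (simp add: K_def algebra_simps)
  finally show ?case by (simp add: f_def)
qed

context sparse_construction
begin

lemma cpx_Psi_real:
  "poly (int_to_cpx_poly (Psi p)) (of_real x) = of_real (\<Sum>j<p. x ^ (j * co p))"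
  by (simp add: Psi_def poly_sum poly_monom)

lemma norm_Psi_le:
  assumes "p \<in> A" "x \<ge> 1"
  shows "norm (poly (int_to_cpx_poly (Psi p)) (of_real x)) \<le> real p * x ^ n"
proof -
  have "(\<Sum>j<p. x ^ (j * co p)) \<le> (\<Sum>j<p. x ^ n)"
  proof (rule sum_mono)
    fix j assume "j \<in> {..<p}"
    then have "j * co p \<le> n" using n_eq[OF assms(1)] by simp
    then show "x ^ (j * co p) \<le> x ^ n" using assms(2) by (rule power_increasing)
  qed
  moreover have "(\<Sum>j<p. x ^ (j * co p)) \<ge> 0" using assms(2) by (intro sum_nonneg) auto
  ultimately show ?thesis unfolding cpx_Psi_real norm_of_real by simp
qed

lemma norm_F_le:
  assumes "\<And>p. p \<in> A \<Longrightarrow> p \<le> N" "x \<ge> 1"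
  shows "norm (poly (int_to_cpx_poly F) (of_real x))
      \<le> (real N * (\<Sum>p\<in>A. c p) + 2 * real r) * x ^ ((r + 1) * n)"
proof -
  let ?X = "x ^ ((r + 1) * n)"
  have X: "x ^ i \<le> ?X" if "i \<le> (r + 1) * n" for i using that assms(2) by (rule power_increasing)
  have "poly (int_to_cpx_poly F) (of_real x) = (\<Sum>p\<in>A. of_int (c p) * poly (int_to_cpx_poly (Psi p)) (of_real x))
      + of_real ((\<Sum>j=1..r. x ^ (j * n)) - real r * ?X)"
    by (simp add: F_def Tail_def poly_sum poly_monom)
  also have "norm \<dots> \<le> norm (\<Sum>p\<in>A. of_int (c p) * poly (int_to_cpx_poly (Psi p)) (of_real x))
      + \<bar>(\<Sum>j=1..r. x ^ (j * n)) - real r * ?X\<bar>"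
    by (rule order_trans[OF norm_triangle_ineq]) (simp only: norm_of_real order_refl)
  also have "norm (\<Sum>p\<in>A. of_int (c p) * poly (int_to_cpx_poly (Psi p)) (of_real x))
      \<le> (\<Sum>p\<in>A. of_int (c p) * (real N * ?X))"
  proof (rule sum_norm_le)
    fix p assume p: "p \<in> A"
    have "norm (poly (int_to_cpx_poly (Psi p)) (of_real x)) \<le> real p * x ^ n"
      by (rule norm_Psi_le[OF p assms(2)])
    also have "\<dots> \<le> real N * ?X" using assms p X[of n] by (intro mult_mono) auto
    finally show "norm (of_int (c p) * poly (int_to_cpx_poly (Psi p)) (of_real x)) \<le> of_int (c p) * (real N * ?X)"
      using c[OF p] by (simp add: norm_mult mult_left_mono)
  qed
  also have "\<dots> = real N * (\<Sum>p\<in>A. c p) * ?X"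
    by (simp only: sum_distrib_right[symmetric] of_int_sum) simp
  also have "\<bar>(\<Sum>j=1..r. x ^ (j * n)) - real r * ?X\<bar> \<le> 2 * real r * ?X"
  proof -
    have "(\<Sum>j=1..r. x ^ (j * n)) \<le> (\<Sum>j=1..r. ?X)" by (intro sum_mono X mult_right_mono) auto
    moreover have "(\<Sum>j=1..r. x ^ (j * n)) \<ge> 0" using assms(2) by (intro sum_nonneg) auto
    moreover have "real r * ?X \<ge> 0" using assms(2) by simp
    ultimately show ?thesis by simp
  qed
  finally show ?thesis by (simp add: distrib_right)
qed

text \<open>On (0,1) all contributions are nonnegative, the tail by its factorisation, and the
  constant term is the prime sum of the weights. So a tiny value of Phi forces a huge value of
  \<open>H\<close>.\<close>

lemma norm_F_ge_1:
  assumes "0 < x" "x < 1"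
  shows "norm (poly (int_to_cpx_poly F) (of_real x)) \<ge> 1"
proof -
  have eq: "poly (int_to_cpx_poly F) (of_real x) = of_real ((\<Sum>p\<in>A. of_int (c p) * (\<Sum>j<p. x ^ (j * co p)))
      + (1 - x ^ n) * (\<Sum>j=1..r. real j * x ^ (j * n)))"
    by (simp add: F_def poly_sum cpx_Psi_real cpx_Tail)
  have "(\<Sum>j<p. x ^ (j * co p)) \<ge> 1" if "p \<in> A" for p
  proof -
    have "0 \<in> {..<p}" using prime_gt_0_nat[OF prime_A[OF that]] by simp
    then have "x ^ (0 * co p) \<le> (\<Sum>j<p. x ^ (j * co p))"
      using assms by (intro member_le_sum) auto
    then show ?thesis by simp
  qed
  then have "(\<Sum>p\<in>A. of_int (c p) * 1) \<le> (\<Sum>p\<in>A. of_int (c p) * (\<Sum>j<p. x ^ (j * co p)))"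
    using c by (intro sum_mono mult_left_mono) (auto simp: less_imp_le)
  moreover have "(\<Sum>p\<in>A. of_int (c p) * 1 :: real) = of_int (\<Sum>p\<in>A. c p)" by simp
  moreover have "(1::real) \<le> of_int (\<Sum>p\<in>A. c p)"
    using prime_ge_1_int[OF ell(1)] by (simp only: of_int_1_le_iff)
  moreover have "(1 - x ^ n) * (\<Sum>j=1..r. real j * x ^ (j * n)) \<ge> 0"
    using assms by (intro mult_nonneg_nonneg sum_nonneg) (auto simp: power_le_one)
  ultimately have "(\<Sum>p\<in>A. of_int (c p) * (\<Sum>j<p. x ^ (j * co p)))
      + (1 - x ^ n) * (\<Sum>j=1..r. real j * x ^ (j * n)) \<ge> 1" by linarith
  then show ?thesis unfolding eq norm_of_real by linarith
qed

text \<open>The cofactor must have its roots in the closed disc. For \<open>H\<close> it is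
  \<open>P\<close>, inside \<open>F\<close>. For \<open>P\<close> the cofactor \<open>H\<close>
  would not do, so \<open>P\<close> is compared with a multiple \<open>Psi q\<close>, whose roots
  are all roots of unity.\<close>

lemma norm_cofactors_le:
  assumes P: "lead_coeff P = 1" "int_to_cpx_poly P = cyclo A" "F = P * H"
    and Pz: "\<And>z. poly (int_to_cpx_poly P) z = 0 \<longleftrightarrow> z \<in> prim_roots A"
    and N: "\<And>p. p \<in> A \<Longrightarrow> p \<le> N" and x: "x \<ge> 1"
  shows "norm (poly (int_to_cpx_poly P) (of_real x)) \<le> (real N * (\<Sum>p\<in>A. c p) + 2 * real r) * x ^ ((r + 1) * n)"
    and "norm (poly (int_to_cpx_poly H) (of_real x)) \<le> (real N * (\<Sum>p\<in>A. c p) + 2 * real r) * x ^ ((r + 1) * n)"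
proof -
  obtain q where q: "q \<in> A" using A(3) by blast
  have q0: "q > 0" using prime_gt_0_nat[OF prime_A[OF q]] .
  have fin: "finite (prim_roots A)" using finite_prim_roots A by blast
  have unit: "norm z = 1" if "poly (int_to_cpx_poly (Psi q)) z = 0" for z
  proof -
    have "z ^ n = 1" using cpx_Psi_mult[OF q, of z] that by simp
    then have "norm z ^ n = 1" by (metis norm_one norm_power)
    then show ?thesis using n_pos by (metis norm_ge_zero power_eq_1_iff less_irrefl abs_of_nonneg real_norm_def)
  qed
  have Psi1: "poly (int_to_cpx_poly (Psi q)) 1 \<noteq> 0"
    using q0 by (simp add: Psi_def poly_sum poly_monom)
  have "cyclo A dvd int_to_cpx_poly (Psi q)"
    unfolding cyclo_def
  proof (rule prod_linear_factors_dvd[OF fin])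
    fix z assume "z \<in> prim_roots A"
    then show "poly (int_to_cpx_poly (Psi q)) z = 0"
      using cpx_Psi_mult[OF q, of z] q by (auto simp: prim_roots_def)
  qed
  then obtain R where "int_to_cpx_poly (Psi q) = int_to_cpx_poly P * R" unfolding P(2) by auto
  then obtain S where S: "Psi q = P * S" using int_monic_dvd_complex[OF P(1)] by metis
  have "norm (poly (int_to_cpx_poly S) (of_real x)) \<ge> 1"
    using unit Psi1 x by (intro norm_int_poly_ge_1) (auto simp: S less_imp_le)
  then have "norm (poly (int_to_cpx_poly P) (of_real x)) \<le> norm (poly (int_to_cpx_poly (Psi q)) (of_real x))"
    by (simp add: S norm_mult mult_le_cancel_left1)
  also have "\<dots> \<le> real q * x ^ n" by (rule norm_Psi_le[OF q x])
  also have "\<dots> \<le> (real N * (\<Sum>p\<in>A. c p) + 2 * real r) * x ^ ((r + 1) * n)"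
  proof (intro mult_mono power_increasing)
    have one: "(1::real) \<le> of_int (\<Sum>p\<in>A. c p)"
      using prime_ge_1_int[OF ell(1)] by (simp only: of_int_1_le_iff)
    then have "real q * 1 \<le> real N * (\<Sum>p\<in>A. c p)"
      using N[OF q] by (intro mult_mono) auto
    then show "real q \<le> real N * (\<Sum>p\<in>A. c p) + 2 * real r" by simp
    show "0 \<le> real N * (\<Sum>p\<in>A. c p) + 2 * real r"
      using one by (intro add_nonneg_nonneg mult_nonneg_nonneg) auto
  qed (use x in auto)
  finally show "norm (poly (int_to_cpx_poly P) (of_real x)) \<le> (real N * (\<Sum>p\<in>A. c p) + 2 * real r) * x ^ ((r + 1) * n)" .
  have "norm (poly (int_to_cpx_poly P) (of_real x)) \<ge> 1"
    using unit Psi1 x by (intro norm_int_poly_ge_1) (auto simp: S less_imp_le)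
  then have "norm (poly (int_to_cpx_poly H) (of_real x)) \<le> norm (poly (int_to_cpx_poly F) (of_real x))"
    by (simp add: P(3) norm_mult mult_le_cancel_right1)
  also have "\<dots> \<le> (real N * (\<Sum>p\<in>A. c p) + 2 * real r) * x ^ ((r + 1) * n)"
    by (rule norm_F_le[OF N x])
  finally show "norm (poly (int_to_cpx_poly H) (of_real x)) \<le> (real N * (\<Sum>p\<in>A. c p) + 2 * real r) * x ^ ((r + 1) * n)" .
qed

end

text \<open>With w = exp (t / L), node 0 is exp (- t) and node \<open>L\<close> is 1. The lower
  bound on \<open>L\<close> keeps the next \<open>card (supp G)\<close> nodes so close to 1 that x^d
  <= e there.\<close>

lemma norm_int_poly_sparse_le:
  fixes G :: "int poly"
  assumes B: "\<And>x. x \<ge> 1 \<Longrightarrow> norm (poly (int_to_cpx_poly G) (of_real x)) \<le> B * x ^ d" "B \<ge> 0"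
    and t: "t > 0" and L: "L > 0" "t * real (card (supp G)) * real d \<le> real L"
  shows "norm (poly (int_to_cpx_poly G) (of_real (exp (- t)))) \<le> B * exp 1 * (2 * real L + 1) ^ card (supp G)"
proof -
  have fin: "finite (supp G)" by (simp add: supp_def)
  have eval: "norm (poly (int_to_cpx_poly G) (of_real x)) = \<bar>\<Sum>j\<in>supp G. of_int (coeff G j) * x ^ j\<bar>" for x
  proof -
    have "poly (int_to_cpx_poly G) (of_real x) = (\<Sum>j\<le>degree G. of_int (coeff G j) * of_real x ^ j)"
      by (simp add: poly_altdef)
    also have "\<dots> = (\<Sum>j\<in>supp G. of_int (coeff G j) * of_real x ^ j)"
      by (rule sum.mono_neutral_right) (auto simp: supp_def)
    also have "\<dots> = of_real (\<Sum>j\<in>supp G. of_int (coeff G j) * x ^ j)" by simp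
    finally show ?thesis by (simp only: norm_of_real)
  qed
  define w where "w = exp (t / real L)"
  have node: "exp (- t) * w ^ i = exp (t * (real i / real L - 1))" for i
    by (simp add: w_def exp_of_nat_mult[symmetric] algebra_simps flip: exp_add)
  have "\<bar>\<Sum>j\<in>supp G. of_int (coeff G j) * (exp (- t) * w ^ 0) ^ j\<bar> \<le> B * exp 1 * (2 * real L + 1) ^ card (supp G)"
  proof (rule sparse_sum_geometric_nodes[OF fin])
    show "w \<ge> 1" using t by (simp add: w_def)
    show "B * exp 1 \<ge> 0" using B(2) by simp
    fix i assume i: "L \<le> i" "i < L + card (supp G)"
    let ?x = "exp (- t) * w ^ i"
    have 0: "real i / real L - 1 = (real i - real L) / real L" using L(1) by (simp add: field_simps)
    have "?x \<ge> 1" unfolding node 0 using t i by simp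
    have "?x ^ d = exp (t * (real i / real L - 1) * real d)"
      unfolding node by (simp add: exp_of_nat_mult[symmetric] mult_ac)
    also have "\<dots> \<le> exp 1"
    proof -
      have "t * (real i - real L) * real d \<le> t * real (card (supp G)) * real d"
        using i t by (intro mult_right_mono mult_left_mono) auto
      then have "t * (real i - real L) * real d \<le> real L" using L(2) by simp
      then show ?thesis unfolding 0 using L(1) by (simp add: divide_le_eq)
    qed
    finally have "B * ?x ^ d \<le> B * exp 1" using B(2) by (intro mult_left_mono)
    then show "\<bar>\<Sum>j\<in>supp G. of_int (coeff G j) * ?x ^ j\<bar> \<le> B * exp 1"
      using B(1)[OF \<open>?x \<ge> 1\<close>] unfolding eval by linarith
  qed simp
  then show ?thesis unfolding eval by simp
qed

section \<open>Large and small values of cyclotomic polynomials on the unit interval\<close>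

lemma norm_integral_le:
  fixes f :: "'a \<Rightarrow> 'b::{banach, second_countable_topology}"
  assumes "integrable M f" "integrable M g" "\<And>x. norm (f x) \<le> g x"
  shows "norm (integral\<^sup>L M f) \<le> integral\<^sup>L M g"
  by (rule order_trans[OF integral_norm_bound Bochner_Integration.integral_mono])
     (use assms in auto)

lemma exp_right_tail:
  assumes "a > 0"
  shows "has_bochner_integral lborel (\<lambda>u. indicator {c..} u * exp (- a * u)) (exp (- a * c) / a :: real)"
proof -
  have *: "((\<lambda>u::real. exp (- a * u)) has_integral exp (- a * c) / a) {c..}"
    by (rule has_integral_exp_minus_to_infinity[OF assms])
  have "(\<lambda>u. exp (- a * u)) absolutely_integrable_on {c..}"
    using * by (intro nonnegative_absolutely_integrable_1) (auto simp: integrable_on_def)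
  then have int: "integrable lborel (\<lambda>u. indicator {c..} u * exp (- a * u))"
    by (subst integrable_completion[symmetric]) (auto simp: set_integrable_def)
  have "((\<lambda>u. indicator {c..} u * exp (- a * u)) has_integral exp (- a * c) / a) UNIV"
    using * unfolding has_integral_restrict_UNIV[symmetric, of _ _ "{c..}"]
    by (rule has_integral_eq[rotated]) auto
  then have "integral\<^sup>L lborel (\<lambda>u. indicator {c..} u * exp (- a * u)) = exp (- a * c) / a"
    using has_integral_integral_lborel[OF int] has_integral_unique by blast
  then show ?thesis using int by (simp add: has_bochner_integral_iff)
qed

lemma exp_left_tail:
  assumes "a > 0"
  shows "has_bochner_integral lborel (\<lambda>u. indicator {..c} u * exp (a * u)) (exp (a * c) / a :: real)"
proof -
  have "has_bochner_integral lborel (\<lambda>u. indicator {-c..} u * exp (- a * u)) (exp (- a * (- c)) / a)"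
    by (rule exp_right_tail[OF assms])
  then show ?thesis
    by (subst lborel_has_bochner_integral_real_affine_iff[where c="-1" and t=0])
       (auto simp: indicator_def minus_le_iff cong: if_cong)
qed

text \<open>In the variable \<open>x = exp (- exp u)\<close> the substitution \<open>x \<mapsto> x\<^sup>p\<close> is the translation of \<open>u\<close> by \<open>ln p\<close>.\<close>

definition log_cyclo :: "nat set \<Rightarrow> real \<Rightarrow> real" where
  "log_cyclo A u = ln (norm (poly (cyclo A) (of_real (exp (- exp u)))))"

text \<open>Substituting t = exp u gives the usual integral of f (ln t) t^z dt / t.\<close>

definition mellin :: "(real \<Rightarrow> real) \<Rightarrow> complex \<Rightarrow> complex" where
  "mellin f z = integral\<^sup>L lborel (\<lambda>u. of_real (f u) * exp (z * of_real u))"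

abbreviation base_log :: "real \<Rightarrow> real" where "base_log \<equiv> \<lambda>u. ln (1 - exp (- exp u))"

lemma log_cyclo_empty: "log_cyclo {} u = base_log u"
proof -
  have "prim_roots {} = {1}" by (auto simp: prim_roots_def)
  then have "poly (cyclo {}) (of_real (exp (- exp u))) = - of_real (1 - exp (- exp u))"
    by (simp add: cyclo_def)
  then show ?thesis unfolding log_cyclo_def by (simp only: norm_minus_cancel norm_of_real) simp
qed

lemma cyclo_nonzero:
  assumes "\<forall>p\<in>A. prime p"
  shows "poly (cyclo A) (of_real (exp (- exp u))) \<noteq> 0"
proof
  assume 0: "poly (cyclo A) (of_real (exp (- exp u))) = 0"
  have fin: "finite (prim_roots A)" using finite_prim_roots[OF assms] .
  then have "of_real (exp (- exp u)) \<in> prim_roots A"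
    using 0 by (auto simp: cyclo_def poly_prod)
  from norm_prim_roots[OF assms this] show False by simp
qed

lemma log_cyclo_insert:
  assumes "finite A" "\<forall>p\<in>A. prime p" "prime p" "p \<notin> A"
  shows "log_cyclo (insert p A) u = log_cyclo A (u + ln (real p)) - log_cyclo A u"
proof -
  let ?x = "complex_of_real (exp (- exp u))"
  have p: "real p > 0" using assms(3) prime_gt_0_nat by simp
  have "?x ^ p = of_real (exp (- exp (u + ln (real p))))"
    using p by (simp add: exp_add exp_of_nat_mult[symmetric] mult.commute flip: of_real_power)
  moreover have "poly (pcompose (cyclo A) (monom 1 p)) ?x = poly (cyclo (insert p A)) ?x * poly (cyclo A) ?x"
    using cyclo_pcompose[OF assms] by simp
  ultimately have "norm (poly (cyclo A) (of_real (exp (- exp (u + ln (real p))))))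
      = norm (poly (cyclo (insert p A)) ?x) * norm (poly (cyclo A) ?x)"
    by (simp add: poly_pcompose poly_monom norm_mult)
  moreover have "poly (cyclo (insert p A)) ?x \<noteq> 0" "poly (cyclo A) ?x \<noteq> 0"
    using cyclo_nonzero assms by auto
  ultimately show ?thesis by (simp add: log_cyclo_def ln_mult)
qed

text \<open>With t = exp u: t exp (- t) <= 1 - exp (- t) <= t and - ln (1 - exp (- t)) <= 1 / (exp t
  - 1) <= 1 / t. Together they put \<open>base_log u\<close> within exp (- |u|) of
  \<open>min u 0\<close>.\<close>

lemma base_log_bounds:
  shows "base_log u \<le> 0" "- base_log u \<le> exp (- u)" "u \<le> v \<Longrightarrow> base_log u \<le> base_log v" "base_log u \<le> u" "u - exp u \<le> base_log u \<or> u > 0"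
proof -
  have e1: "exp (- exp u) < 1" "exp (- exp v) < 1" by auto
  show "base_log u \<le> 0" using e1 by (simp add: ln_le_zero_iff)
  show "u \<le> v \<Longrightarrow> base_log u \<le> base_log v" using e1 by simp
  have "1 - exp (- exp u) \<le> exp u" using exp_ge_add_one_self[of "- exp u"] by linarith
  then show "base_log u \<le> u" using e1 by (metis diff_gt_0_iff_gt exp_gt_zero ln_exp ln_mono)
  let ?t = "exp u"
  have t: "?t > 0" by simp
  have "ln (1 / (1 - exp (- ?t))) \<le> 1 / (1 - exp (- ?t)) - 1"
    using e1 by (intro ln_le_minus_one) auto
  also have "\<dots> = 1 / (exp ?t - 1)"
    using e1 by (simp add: exp_minus field_simps)
  also have "\<dots> \<le> 1 / ?t"
  proof (intro divide_left_mono)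
    show "?t \<le> exp ?t - 1" using exp_ge_add_one_self[of ?t] by linarith
  qed (use t in auto)
  finally show "- base_log u \<le> exp (- u)" using e1 by (simp add: ln_div exp_minus inverse_eq_divide)
  show "u - exp u \<le> base_log u \<or> u > 0"
  proof (cases "u > 0")
    case False
    then have t1: "?t \<le> 1" by simp
    have "?t * exp (- ?t) \<le> 1 - exp (- ?t)"
      using exp_ge_add_one_self[of ?t] by (simp add: exp_minus field_simps)
    then have "ln (?t * exp (- ?t)) \<le> base_log u" using e1 by (intro ln_mono) auto
    then show ?thesis by (simp add: ln_mult)
  qed simp
qed

text \<open>Each prime turns the function into a difference of two values and so doubles the bound;
  the shift by ln p >= 0 only decreases \<open>- base_log\<close>.\<close>

lemma abs_log_cyclo_le:
  assumes "finite A" "\<forall>p\<in>A. prime p"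
  shows "\<bar>log_cyclo A u\<bar> \<le> 2 ^ card A * (- base_log u)"
  using assms
proof (induction A arbitrary: u)
  case empty
  then show ?case using base_log_bounds(1)[of u] by (simp add: log_cyclo_empty)
next
  case (insert p A)
  then have p: "prime p" "real p \<ge> 1" using prime_ge_1_nat[of p] by auto
  have "log_cyclo (insert p A) u = log_cyclo A (u + ln (real p)) - log_cyclo A u"
    using insert by (intro log_cyclo_insert) auto
  moreover have "\<bar>log_cyclo A (u + ln (real p))\<bar> \<le> 2 ^ card A * (- base_log (u + ln (real p)))"
    "\<bar>log_cyclo A u\<bar> \<le> 2 ^ card A * (- base_log u)" using insert by auto
  moreover have "2 ^ card A * (- base_log (u + ln (real p))) \<le> 2 ^ card A * (- base_log u)"
    using base_log_bounds(3)[of u "u + ln (real p)"] p by (intro mult_left_mono) auto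
  ultimately have "\<bar>log_cyclo (insert p A) u\<bar> \<le> 2 * (2 ^ card A * (- base_log u))" by linarith
  then show ?case using insert.hyps by simp
qed

lemma borel_measurable_log_cyclo [measurable]: "log_cyclo A \<in> borel_measurable borel"
proof -
  have "continuous_on UNIV (\<lambda>u. poly (cyclo A) (of_real (exp (- exp u))))"
    by (intro continuous_intros)
  then have "(\<lambda>u. poly (cyclo A) (of_real (exp (- exp u)))) \<in> borel_measurable borel"
    by (rule borel_measurable_continuous_onI)
  then show ?thesis unfolding log_cyclo_def[abs_def] by measurable
qed

section \<open>Mellin transforms of the logarithms\<close>

lemma norm_exp_mult_of_real: "norm (exp (z * of_real u)) = exp (Re z * u)"
  by (simp add: norm_exp_eq_Re)

text \<open>\<open>D\<close> is a common integrable majorant. On the left, half of the exponential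
  weight is spent on the linear growth: - u exp (s u) <= (2 / s) exp (s u / 2).\<close>

lemma base_log_dominated:
  assumes "0 < s" "s < 1"
  defines "D \<equiv> \<lambda>u. indicator {..0} u * exp (s / 2 * u) * (2 / s) + indicator {..0} u * exp (s * u)
      + indicator {0..} u * exp (- (1 - s) * u)"
  shows "integrable lborel D" "\<And>u. (- base_log u) * exp (s * u) \<le> D u"
    "\<And>u. \<bar>min u 0\<bar> * exp (s * u) \<le> D u"
proof -
  show "integrable lborel D"
    unfolding D_def using assms(1,2) exp_left_tail[of "s / 2" 0] exp_left_tail[of s 0] exp_right_tail[of "1 - s" 0]
    by (intro Bochner_Integration.integrable_add integrable_mult_left) (auto simp: has_bochner_integral_iff)
  have neg: "(- u) * exp (s * u) \<le> exp (s / 2 * u) * (2 / s)" for u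
  proof -
    have "- (s / 2 * u) \<le> exp (- (s / 2 * u))"
      using exp_ge_add_one_self[of "- (s / 2 * u)"] by linarith
    then have "- (s / 2 * u) * exp (s * u) \<le> exp (- (s / 2 * u)) * exp (s * u)"
      by (intro mult_right_mono) auto
    also have "\<dots> = exp (s / 2 * u)" by (simp flip: exp_add)
    finally show ?thesis using assms(1) by (simp add: field_simps)
  qed
  show "(- base_log u) * exp (s * u) \<le> D u" for u
  proof (cases "u > 0")
    case True
    have "(- base_log u) * exp (s * u) \<le> exp (- u) * exp (s * u)"
      using base_log_bounds(2) by (intro mult_right_mono) auto
    also have "\<dots> = exp (- (1 - s) * u)" by (simp add: algebra_simps flip: exp_add)
    finally show ?thesis using True by (simp add: D_def)
  next
    case False
    then have "- base_log u \<le> - u + 1" using base_log_bounds(5)[of u] by (auto intro: order_trans[of _ "exp u - u"])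
    then have "(- base_log u) * exp (s * u) \<le> (- u + 1) * exp (s * u)" by (intro mult_right_mono) auto
    also have "\<dots> = (- u) * exp (s * u) + exp (s * u)" by (simp add: algebra_simps)
    also have "\<dots> \<le> D u" using False neg[of u] assms(1) by (simp add: D_def indicator_def)
    finally show ?thesis .
  qed
  show "\<bar>min u 0\<bar> * exp (s * u) \<le> D u" for u
    using neg[of u] assms(1) by (auto simp: D_def indicator_def min_def intro: add_increasing2)
qed

lemma integrable_log_cyclo:
  assumes "finite A" "\<forall>p\<in>A. prime p" "0 < Re z" "Re z < 1"
  shows "integrable lborel (\<lambda>u. of_real (log_cyclo A u) * exp (z * of_real u))"
proof (rule Bochner_Integration.integrable_bound)
  note D = base_log_dominated[OF assms(3,4)]
  show "integrable lborel (\<lambda>u. 2 ^ card A * (indicator {..0} u * exp (Re z / 2 * u) * (2 / Re z) +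
      indicator {..0} u * exp (Re z * u) + indicator {0..} u * exp (- (1 - Re z) * u)))"
    using D(1) by (rule integrable_mult_right)
  have "norm (of_real (log_cyclo A u) * exp (z * of_real u)) \<le> 2 ^ card A * ((- base_log u) * exp (Re z * u))" for u
    using mult_right_mono[OF abs_log_cyclo_le[OF assms(1,2), of u], of "exp (Re z * u)"]
    by (simp only: norm_mult norm_exp_mult_of_real norm_of_real mult.assoc exp_ge_zero simp_thms)
  also have "2 ^ card A * ((- base_log u) * exp (Re z * u)) \<le> 2 ^ card A * (indicator {..0} u * exp (Re z / 2 * u) * (2 / Re z) +
      indicator {..0} u * exp (Re z * u) + indicator {0..} u * exp (- (1 - Re z) * u))" for u
    by (intro mult_left_mono D(2)) auto
  finally have le: "norm (of_real (log_cyclo A u) * exp (z * of_real u)) \<le>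
     2 ^ card A * (indicator {..0} u * exp (Re z / 2 * u) * (2 / Re z) +
      indicator {..0} u * exp (Re z * u) + indicator {0..} u * exp (- (1 - Re z) * u))" for u .
  show "AE u in lborel. norm (of_real (log_cyclo A u) * exp (z * of_real u)) \<le>
     norm (2 ^ card A * (indicator {..0} u * exp (Re z / 2 * u) * (2 / Re z) +
      indicator {..0} u * exp (Re z * u) + indicator {0..} u * exp (- (1 - Re z) * u)))"
    unfolding real_norm_def using le by (intro AE_I2) (rule order_trans[OF _ abs_ge_self])
qed measurable

lemma mellin_insert:
  assumes "finite A" "\<forall>p\<in>A. prime p" "prime p" "p \<notin> A" "0 < Re z" "Re z < 1"
  shows "mellin (log_cyclo (insert p A)) z = (exp (- (z * of_real (ln (real p)))) - 1) * mellin (log_cyclo A) z"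
proof -
  let ?l = "ln (real p)"
  let ?f = "\<lambda>u. of_real (log_cyclo A u) * exp (z * of_real u)"
  have int: "integrable lborel ?f" using integrable_log_cyclo assms by blast
  have eq: "of_real (log_cyclo (insert p A) u) * exp (z * of_real u)
      = exp (- (z * of_real ?l)) * ?f (?l + 1 * u) - ?f u" for u
  proof -
    have "exp (- (z * of_real ?l)) * exp (z * of_real (?l + 1 * u)) = exp (z * of_real u)"
      by (simp add: algebra_simps flip: exp_add)
    then have "exp (- (z * of_real ?l)) * ?f (?l + 1 * u) = of_real (log_cyclo A (u + ?l)) * exp (z * of_real u)"
      by (metis (no_types, opaque_lifting) add.commute mult.left_commute mult_1)
    then show ?thesis
      unfolding log_cyclo_insert[OF assms(1-4), of u] by (simp only: of_real_diff left_diff_distrib)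
  qed
  have int': "integrable lborel (\<lambda>u. ?f (?l + 1 * u))"
    by (rule lborel_integrable_real_affine[OF int]) simp
  have shift: "(\<integral>u. ?f (?l + 1 * u) \<partial>lborel) = (\<integral>u. ?f u \<partial>lborel)"
    using lborel_integral_real_affine[of 1 ?f ?l] by simp
  have "mellin (log_cyclo (insert p A)) z
      = (\<integral>u. exp (- (z * of_real ?l)) * ?f (?l + 1 * u) - ?f u \<partial>lborel)"
    unfolding mellin_def by (simp only: eq)
  also have "\<dots> = exp (- (z * of_real ?l)) * (\<integral>u. ?f (?l + 1 * u) \<partial>lborel) - (\<integral>u. ?f u \<partial>lborel)"
    using int int' by (subst Bochner_Integration.integral_diff) (auto simp del: of_real_mult)
  finally show ?thesis unfolding shift mellin_def by (simp add: algebra_simps)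
qed

lemma mellin_log_cyclo:
  assumes "finite A" "\<forall>p\<in>A. prime p" "0 < Re z" "Re z < 1"
  shows "mellin (log_cyclo A) z = (\<Prod>p\<in>A. exp (- (z * of_real (ln (real p)))) - 1) * mellin base_log z"
  using assms(1,2)
proof (induction A)
  case empty
  show ?case by (simp add: log_cyclo_empty[abs_def])
next
  case (insert p A)
  then show ?case using mellin_insert[of A p z] assms(3,4) by simp
qed

text \<open>The transform is - Gamma(z) zeta(z + 1), with double pole - 1 / z^2 at 0. That pole is
  the transform of \<open>min u 0\<close>; the difference is at most exp (- |u|), whose integral
  against exp (s u) is 1 / (1 + s) + 1 / (1 - s) <= 1 + 2.\<close>

lemma mellin_base_log:
  assumes "0 < Re z" "Re z \<le> 1 / 2"
  shows "norm (mellin base_log z + 1 / z\<^sup>2) \<le> 3"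
proof -
  have z0: "z \<noteq> 0" using assms by auto
  let ?s = "Re z"
  note D = base_log_dominated[of ?s, OF assms(1)]
  define m where "m u = of_real (min u 0) * exp (z * complex_of_real u)" for u
  have [measurable]: "m \<in> borel_measurable borel" unfolding m_def[abs_def] by measurable
  have int_m: "integrable lborel m"
  proof (rule Bochner_Integration.integrable_bound)
    show "integrable lborel (\<lambda>u. indicator {..0} u * exp (?s / 2 * u) * (2 / ?s) +
      indicator {..0} u * exp (?s * u) + indicator {0..} u * exp (- (1 - ?s) * u))"
      using D(1) assms by simp
    show "AE u in lborel. norm (m u) \<le> norm (indicator {..0} u * exp (?s / 2 * u) * (2 / ?s) +
      indicator {..0} u * exp (?s * u) + indicator {0..} u * exp (- (1 - ?s) * u))"
      unfolding real_norm_def using assms D(3)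
      by (intro AE_I2 order_trans[OF _ abs_ge_self])
         (simp only: m_def norm_mult norm_of_real norm_exp_mult_of_real)
  qed measurable
  have "integral\<^sup>L lborel m = - 1 / z\<^sup>2"
  proof -
    define F where "F u = (of_real u / z - 1 / z\<^sup>2) * exp (z * complex_of_real u)" for u
    have ind: "indicator (einterval (- \<infinity>) 0) u *\<^sub>R (of_real u * exp (z * complex_of_real u)) = m u" for u
      by (auto simp: m_def indicator_def einterval_def min_def)
    have "(LBINT u = - \<infinity>..0. of_real u * exp (z * complex_of_real u)) = - 1 / z\<^sup>2 - 0"
    proof (rule interval_integral_FTC_integrable[where F = F])
      fix x :: real
      have "((\<lambda>u. (of_real u / z - 1 / z\<^sup>2) * exp (z * of_real u)) has_vector_derivative
          of_real x * exp (z * of_real x)) (at x)"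
        using z0 by (auto intro!: derivative_eq_intros has_vector_derivative_real_field
          simp: field_simps power2_eq_square)
      then show "(F has_vector_derivative of_real x * exp (z * complex_of_real x)) (at x)"
        by (simp add: F_def[abs_def])
      show "isCont (\<lambda>x. of_real x * exp (z * complex_of_real x)) x" by (intro continuous_intros)
    next
      show "set_integrable lborel (einterval (- \<infinity>) 0) (\<lambda>u. of_real u * exp (z * complex_of_real u))"
        unfolding set_integrable_def ind by (rule int_m)
      have "(F \<longlongrightarrow> 0) at_bot"
      proof (rule Lim_null_comparison)
        show "\<forall>\<^sub>F u in at_bot. norm (F u) \<le> (\<bar>u\<bar> / norm z + 1 / norm z ^ 2) * exp (?s * u)"
        proof (rule always_eventually, rule allI)
          fix u
          have "norm (of_real u / z - 1 / z\<^sup>2) \<le> \<bar>u\<bar> / norm z + 1 / norm z ^ 2"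
            by (rule order_trans[OF norm_triangle_ineq4]) (simp add: norm_divide norm_power)
          then show "norm (F u) \<le> (\<bar>u\<bar> / norm z + 1 / norm z ^ 2) * exp (?s * u)"
            unfolding F_def norm_mult norm_exp_mult_of_real by (intro mult_right_mono) auto
        qed
        have "norm z > 0" using z0 by simp
        then show "((\<lambda>u. (\<bar>u\<bar> / norm z + 1 / norm z ^ 2) * exp (?s * u)) \<longlongrightarrow> 0) at_bot"
          using assms(1) by real_asymp
      qed
      then show "((F \<circ> real_of_ereal) \<longlongrightarrow> 0) (at_right (- \<infinity>))" by (simp add: ereal_tendsto_simps)
      have "isCont F 0" unfolding F_def by (intro continuous_intros) (use z0 in auto)
      then have "(F \<longlongrightarrow> F 0) (at_left 0)" using isCont_def filterlim_at_split by blast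
      then show "((F \<circ> real_of_ereal) \<longlongrightarrow> - 1 / z\<^sup>2) (at_left 0)"
        unfolding zero_ereal_def by (simp add: ereal_tendsto_simps F_def)
    qed simp
    then show ?thesis
      unfolding interval_lebesgue_integral_def set_lebesgue_integral_def ind by simp
  qed
  moreover have int_log: "integrable lborel (\<lambda>u. of_real (base_log u) * exp (z * complex_of_real u))"
    using integrable_log_cyclo[of "{}" z] assms by (simp add: log_cyclo_empty)
  ultimately have "mellin base_log z + 1 / z\<^sup>2 = (\<integral>u. of_real (base_log u) * exp (z * of_real u) - m u \<partial>lborel)"
    using int_m by (simp add: mellin_def)
  also have "norm \<dots> \<le> (\<integral>u. indicator {..0} u * exp ((1 + ?s) * u) + indicator {0..} u * exp (- (1 - ?s) * u) \<partial>lborel)"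
  proof (rule norm_integral_le)
    show "integrable lborel (\<lambda>u. of_real (base_log u) * exp (z * of_real u) - m u)"
      using int_log int_m by (rule Bochner_Integration.integrable_diff)
    show "integrable lborel (\<lambda>u. indicator {..0} u * exp ((1 + ?s) * u) + indicator {0..} u * exp (- (1 - ?s) * u))"
      using assms exp_left_tail[of "1 + ?s" 0] exp_right_tail[of "1 - ?s" 0]
      by (intro Bochner_Integration.integrable_add) (auto simp: has_bochner_integral_iff)
    fix u :: real
    have "\<bar>base_log u - min u 0\<bar> \<le> indicator {..0} u * exp u + indicator {0..} u * exp (- u)"
      using base_log_bounds(1,2,4,5)[of u] by (auto simp: indicator_def min_def)
    then have "\<bar>base_log u - min u 0\<bar> * exp (?s * u)
        \<le> (indicator {..0} u * exp u + indicator {0..} u * exp (- u)) * exp (?s * u)"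
      by (intro mult_right_mono) auto
    also have "\<dots> = indicator {..0} u * exp ((1 + ?s) * u) + indicator {0..} u * exp (- (1 - ?s) * u)"
      by (simp add: indicator_def algebra_simps flip: exp_add)
    also have "\<bar>base_log u - min u 0\<bar> * exp (?s * u) = norm (of_real (base_log u) * exp (z * of_real u) - m u)"
    proof -
      have "of_real (base_log u) * exp (z * of_real u) - m u = of_real (base_log u - min u 0) * exp (z * of_real u)"
        by (simp add: m_def left_diff_distrib)
      then show ?thesis by (simp only: norm_mult norm_of_real norm_exp_mult_of_real)
    qed
    finally show "norm (of_real (base_log u) * exp (z * of_real u) - m u)
      \<le> indicator {..0} u * exp ((1 + ?s) * u) + indicator {0..} u * exp (- (1 - ?s) * u)" .
  qed
  also have "\<dots> = 1 / (1 + ?s) + 1 / (1 - ?s)"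
    using has_bochner_integral_add[OF exp_left_tail[of "1 + ?s" 0] exp_right_tail[of "1 - ?s" 0]] assms
    by (auto simp: has_bochner_integral_iff)
  also have "\<dots> \<le> 1 + 2"
    using assms by (intro add_mono) (auto simp: field_simps)
  finally show ?thesis by simp
qed

text \<open>If \<open>f\<close> is bounded above, its Mellin transform at \<open>z\<close> cannot be much larger than the one
  at the real point \<open>Re z\<close>, because \<open>\<bar>f\<bar> = 2 f\<^sup>+ - f\<close>.\<close>

lemma mellin_one_sided_bound:
  fixes f :: "real \<Rightarrow> real"
  assumes [measurable]: "f \<in> borel_measurable borel"
    and int: "integrable lborel (\<lambda>u. f u * exp (Re z * u))"
    and s: "0 < Re z" "Re z < 1" and "M \<ge> 0" "C \<ge> 0"
    and le: "\<And>u. u \<le> K \<Longrightarrow> f u \<le> M" "\<And>u. u \<ge> K \<Longrightarrow> f u \<le> C * exp (- u)"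
  shows "norm (mellin f z) \<le> 2 * (M * (exp (Re z * K) / Re z) + C * (exp (- (1 - Re z) * K) / (1 - Re z)))
      + norm (mellin f (of_real (Re z)))"
proof -
  let ?s = "Re z"
  \<comment> \<open>\<open>B\<close> majorises the positive part of f(u) exp (s u), so |f| exp (s u)
    <= 2 B - f exp (s u). The integral of the last term is the transform at the real point.\<close>
  define B where "B u = M * (indicator {..K} u * exp (?s * u)) + C * (indicator {K..} u * exp (- (1 - ?s) * u))" for u
  have B: "has_bochner_integral lborel B (M * (exp (?s * K) / ?s) + C * (exp (- (1 - ?s) * K) / (1 - ?s)))"
    unfolding B_def using s
    by (intro has_bochner_integral_add has_bochner_integral_mult_right exp_left_tail exp_right_tail) auto
  have B0: "B u \<ge> 0" for u unfolding B_def using assms(5,6) by simp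
  have fB: "f u * exp (?s * u) \<le> B u" for u
  proof (cases "u \<le> K")
    case True
    then have "f u * exp (?s * u) \<le> M * exp (?s * u)" using le(1) by (intro mult_right_mono) auto
    also have "\<dots> \<le> B u" using True assms(6) by (auto simp: B_def indicator_def)
    finally show ?thesis .
  next
    case False
    then have "f u * exp (?s * u) \<le> C * exp (- u) * exp (?s * u)" using le(2) by (intro mult_right_mono) auto
    also have "\<dots> = C * exp (- (1 - ?s) * u)" by (simp add: algebra_simps flip: exp_add)
    also have "\<dots> = B u" using False by (simp add: B_def)
    finally show ?thesis .
  qed
  have "norm (mellin f z) \<le> (\<integral>u. 2 * B u - f u * exp (?s * u) \<partial>lborel)"
    unfolding mellin_def
  proof (rule norm_integral_le)
    have nrm: "norm (of_real (f u) * exp (z * of_real u)) = \<bar>f u * exp (?s * u)\<bar>" for u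
      by (simp add: norm_mult norm_exp_mult_of_real abs_mult)
    show "integrable lborel (\<lambda>u. of_real (f u) * exp (z * of_real u))"
      using int by (rule Bochner_Integration.integrable_bound) (measurable, simp only: nrm real_norm_def, simp)
    show "integrable lborel (\<lambda>u. 2 * B u - f u * exp (?s * u))"
      using int B by (auto simp: has_bochner_integral_iff)
    show "norm (of_real (f u) * exp (z * of_real u)) \<le> 2 * B u - f u * exp (?s * u)" for u
      unfolding nrm using fB[of u] B0[of u] by linarith
  qed
  also have "\<dots> = 2 * (M * (exp (?s * K) / ?s) + C * (exp (- (1 - ?s) * K) / (1 - ?s)))
      - (\<integral>u. f u * exp (?s * u) \<partial>lborel)"
    using int B by (subst Bochner_Integration.integral_diff) (auto simp: has_bochner_integral_iff)
  also have "\<bar>\<integral>u. f u * exp (?s * u) \<partial>lborel\<bar> = norm (mellin f (of_real ?s))"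
  proof -
    have "mellin f (of_real ?s) = (\<integral>u. complex_of_real (f u * exp (?s * u)) \<partial>lborel)"
      unfolding mellin_def by (intro Bochner_Integration.integral_cong) (auto simp flip: exp_of_real)
    also have "\<dots> = of_real (\<integral>u. f u * exp (?s * u) \<partial>lborel)"
      by (rule integral_complex_of_real)
    finally show ?thesis by (simp only: norm_of_real)
  qed
  then have "- (\<integral>u. f u * exp (?s * u) \<partial>lborel) \<le> norm (mellin f (of_real ?s))" by linarith
  ultimately show ?thesis by linarith
qed

text \<open>Here t stands for ln p / ln N. The angle a = 4 pi t / 3 lies in [2 pi / 3, 4 pi / 3], so
  cos a <= -1/2, and the modulus d = 2^(-t) is at least 1/2. Hence d^2 - 2 d cos a + 1 >= 7/4 >
  1.3^2.\<close>

lemma norm_exp_minus_one_ge: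
  fixes t :: real
  assumes "1 / 2 \<le> t" "t \<le> 1"
  shows "norm (exp (- (Complex (ln 2) (4 * pi / 3) * of_real t)) - 1) \<ge> 13 / 10"
proof -
  define d where "d = exp (- (ln 2 * t))"
  define a where "a = 4 * pi / 3 * t"
  have "exp (- ln 2) \<le> d" unfolding d_def using assms by (simp add: mult_left_le)
  then have d: "d \<ge> 1 / 2" by (simp add: exp_minus)
  have "cos a \<le> - 1 / 2"
  proof -
    have "cos (pi / 3) \<le> cos \<bar>a - pi\<bar>"
    proof (rule cos_monotone_0_pi_le)
      have "2 * pi / 3 \<le> a" "a \<le> 4 * pi / 3" using assms pi_gt_zero by (auto simp: a_def field_simps)
      then show "\<bar>a - pi\<bar> \<le> pi / 3" by linarith
    qed (use pi_gt_zero in auto)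
    also have "cos \<bar>a - pi\<bar> = - cos a" by (simp add: cos_diff)
    finally show ?thesis by (simp add: cos_60)
  qed
  have "exp (- (Complex (ln 2) (4 * pi / 3) * of_real t)) = Complex (d * cos a) (- (d * sin a))"
    by (simp add: complex_eq_iff Re_exp Im_exp d_def a_def)
  then have "norm (exp (- (Complex (ln 2) (4 * pi / 3) * of_real t)) - 1) ^ 2 = (d * cos a - 1)\<^sup>2 + (d * sin a)\<^sup>2"
    by (simp add: cmod_power2)
  also have "\<dots> = d\<^sup>2 * ((cos a)\<^sup>2 + (sin a)\<^sup>2) - 2 * d * cos a + 1"
    by algebra
  also have "\<dots> = d\<^sup>2 - 2 * d * cos a + 1" by simp
  also have "\<dots> \<ge> (1 / 2)\<^sup>2 + 2 * (1 / 2) * (1 / 2) + 1"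
  proof -
    have "d * (- cos a) \<ge> 1 / 2 * (1 / 2)" using d \<open>cos a \<le> - 1 / 2\<close> by (intro mult_mono) auto
    moreover have "d\<^sup>2 \<ge> (1 / 2)\<^sup>2" using d by (intro power_mono) auto
    ultimately show ?thesis by simp
  qed
  finally have "norm (exp (- (Complex (ln 2) (4 * pi / 3) * of_real t)) - 1) ^ 2 \<ge> (13 / 10)\<^sup>2"
    by (simp add: power2_eq_square)
  then show ?thesis by (rule power2_le_imp_le) simp
qed

text \<open>The Mellin transform of \<open>log_cyclo A\<close> at \<open>(ln 2 + 4 \<pi> \<i> / 3) / ln N\<close> is of size at least
  \<open>1.3\<^sup>k\<close>, because each factor \<open>p\<^sup>-\<^sup>z - 1\<close> with \<open>\<surd>N \<le> p \<le> N\<close> is large, whereas at the real point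
  \<open>ln 2 / ln N\<close> each factor is at most \<open>1/2\<close>.\<close>

lemma log_cyclo_large:
  fixes sgn :: real
  assumes A: "finite A" "\<forall>p\<in>A. prime p" and N: "\<And>p. p \<in> A \<Longrightarrow> sqrt (real N) \<le> real p \<and> p \<le> N"
    and L: "ln (real N) \<ge> 12"
    and sgn: "\<bar>sgn\<bar> = 1"
    and le: "\<And>u. u \<le> real (card A) \<Longrightarrow> sgn * log_cyclo A u \<le> M" "M \<ge> 0"
  shows "(13 / 10) ^ card A \<le> 4 * M * ln (real N) * exp (real (card A) / ln (real N)) + 4
      + (4 * ln (real N) ^ 2 + 3) / 2 ^ card A"
proof -
  define k where "k = card A"
  define l where "l = ln (real N)"
  define z where "z = Complex (ln 2) (4 * pi / 3) / of_real l"
  have l: "l \<ge> 12" using L by (simp add: l_def)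
  have N1: "real N > 0" using L by (cases "N = 0") auto
  have ln2: "1 / 2 \<le> ln (2::real)" "ln (2::real) \<le> 8 / 10"
    using ln2_ge_two_thirds ln2_le_25_over_36 by auto
  have Re_z: "Re z = ln 2 / l" by (simp add: z_def)
  have s: "0 < Re z" "Re z \<le> 1 / 10" using ln2 l by (auto simp: Re_z field_simps)
  have t: "1 / 2 \<le> ln (real p) / l" "ln (real p) / l \<le> 1" if "p \<in> A" for p
  proof -
    have p: "real p > 0" using A(2) that prime_gt_0_nat by simp
    have "ln (sqrt (real N)) \<le> ln (real p)" using N[OF that] N1 by (intro ln_mono) auto
    then have "l / 2 \<le> ln (real p)" using N1 by (simp add: ln_sqrt l_def)
    then show "1 / 2 \<le> ln (real p) / l" using l by (simp add: field_simps)
    have "ln (real p) \<le> ln (real N)" using N[OF that] p by (intro ln_mono) auto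
    then show "ln (real p) / l \<le> 1" using l by (simp add: l_def)
  qed
  define f where "f u = sgn * log_cyclo A u" for u
  have mellin_f: "mellin f w = of_real sgn * mellin (log_cyclo A) w" for w
    unfolding mellin_def f_def by (simp add: mult.assoc)
  have norm_f: "norm (mellin f w) = norm (mellin (log_cyclo A) w)" for w
    using sgn by (simp add: mellin_f norm_mult)
  have large: "(13 / 10) ^ k \<le> norm (mellin f z)"
  proof -
    have "(13 / 10) ^ k = (\<Prod>p\<in>A. 13 / 10 :: real)" by (simp add: k_def)
    also have "\<dots> \<le> (\<Prod>p\<in>A. norm (exp (- (z * of_real (ln (real p)))) - 1))"
    proof (rule prod_mono, intro conjI)
      fix p assume p: "p \<in> A"
      have "z * of_real (ln (real p)) = Complex (ln 2) (4 * pi / 3) * of_real (ln (real p) / l)"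
        by (simp add: z_def)
      then show "13 / 10 \<le> norm (exp (- (z * of_real (ln (real p)))) - 1)"
        using norm_exp_minus_one_ge[OF t[OF p]] by simp
    qed simp
    \<comment> \<open>This is where ln N >= 12 enters: it gives |z| <= 1/2, so the main term 1 / z^2
      has modulus at least 4 and exceeds the error 3 by 1.\<close>
    also have "\<dots> \<le> (\<Prod>p\<in>A. norm (exp (- (z * of_real (ln (real p)))) - 1)) * norm (mellin base_log z)"
    proof -
      have "norm z ^ 2 = ((ln 2)\<^sup>2 + (4 * pi / 3)\<^sup>2) / l\<^sup>2"
        by (simp add: z_def norm_divide power_divide cmod_power2)
      also have "\<dots> \<le> (1\<^sup>2 + (16 / 3)\<^sup>2) / 12\<^sup>2"
      proof (rule frac_le)
        have "4 * pi / 3 \<le> 16 / 3" using pi_less_4 by simp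
        then show "(ln 2)\<^sup>2 + (4 * pi / 3)\<^sup>2 \<le> 1\<^sup>2 + (16 / 3 :: real)\<^sup>2"
          using ln2 by (intro add_mono power_mono) auto
        show "12\<^sup>2 \<le> l\<^sup>2" using l by (intro power_mono) auto
      qed auto
      also have "\<dots> \<le> 1 / 4" by (simp add: power2_eq_square)
      finally have "norm z ^ 2 \<le> 1 / 4" .
      moreover have "norm z ^ 2 > 0" using s by auto
      ultimately have "norm (1 / z\<^sup>2) \<ge> 4" by (simp add: norm_divide norm_power field_simps)
      moreover have "norm (1 / z\<^sup>2) \<le> norm (mellin base_log z + 1 / z\<^sup>2) + norm (mellin base_log z)"
        using norm_triangle_ineq4[of "mellin base_log z + 1 / z\<^sup>2" "mellin base_log z"] by simp
      ultimately have "norm (mellin base_log z) \<ge> 1" using mellin_base_log[of z] s by simp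
      then show ?thesis
        using mult_left_mono[of 1 "norm (mellin base_log z)" "\<Prod>p\<in>A. norm (exp (- (z * of_real (ln (real p)))) - 1)"]
        by (simp add: prod_nonneg)
    qed
    also have "\<dots> = norm (mellin f z)"
      using mellin_log_cyclo[OF A] s by (simp add: norm_f norm_mult prod_norm)
    finally show ?thesis .
  qed
  have small: "norm (mellin f (of_real (Re z))) \<le> (4 * l\<^sup>2 + 3) / 2 ^ k"
  proof -
    have "norm (mellin f (of_real (Re z))) = (\<Prod>p\<in>A. norm (exp (- (of_real (Re z) * of_real (ln (real p)))) - 1 :: complex))
        * norm (mellin base_log (of_real (Re z)))"
      using mellin_log_cyclo[OF A, of "of_real (Re z)"] s by (simp add: norm_f norm_mult prod_norm)
    also have "\<dots> \<le> (\<Prod>p\<in>A. 1 / 2) * (4 * l\<^sup>2 + 3)"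
    proof (intro mult_mono prod_mono conjI)
      fix p assume p: "p \<in> A"
      define x where "x = ln 2 * (ln (real p) / l)"
      have "0 \<le> x" unfolding x_def using t[OF p] ln2 by (intro mult_nonneg_nonneg) linarith+
      have "x \<le> ln 2 * 1" unfolding x_def using t[OF p] ln2 by (intro mult_left_mono) linarith+
      then have "x \<le> ln 2" by simp
      with \<open>0 \<le> x\<close> have "exp (- ln 2) \<le> exp (- x)" "exp (- x) \<le> 1" by auto
      then have "\<bar>exp (- x) - 1\<bar> \<le> 1 / 2" by (simp add: exp_minus)
      moreover have "exp (- (of_real (Re z) * of_real (ln (real p)))) - 1 = (of_real (exp (- x) - 1) :: complex)"
        by (simp add: x_def Re_z exp_of_real[symmetric])
      ultimately show "norm (exp (- (of_real (Re z) * of_real (ln (real p)))) - 1 :: complex) \<le> 1 / 2"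
        by (simp only: norm_of_real)
    next
      have "norm (mellin base_log (of_real (Re z))) \<le> norm (mellin base_log (of_real (Re z)) + 1 / (of_real (Re z))\<^sup>2)
          + norm (1 / (of_real (Re z))\<^sup>2 :: complex)"
        using norm_triangle_ineq4[of "mellin base_log (of_real (Re z)) + 1 / (of_real (Re z))\<^sup>2" "1 / (of_real (Re z))\<^sup>2"]
        by simp
      also have "\<dots> \<le> 3 + 4 * l\<^sup>2"
      proof (intro add_mono mellin_base_log)
        have "norm (1 / (of_real (Re z))\<^sup>2 :: complex) = l\<^sup>2 * (1 / ln 2)\<^sup>2"
          by (simp add: Re_z norm_divide norm_power power_divide)
        also have "\<dots> \<le> l\<^sup>2 * 2\<^sup>2"
          using ln2 by (intro mult_left_mono power_mono) (auto simp: field_simps)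
        finally show "norm (1 / (of_real (Re z))\<^sup>2 :: complex) \<le> 4 * l\<^sup>2" by simp
      qed (use s in auto)
      finally show "norm (mellin base_log (of_real (Re z))) \<le> 4 * l\<^sup>2 + 3" by simp
    qed (auto intro: prod_nonneg)
    also have "\<dots> = (4 * l\<^sup>2 + 3) / 2 ^ k" by (simp add: k_def power_divide)
    finally show ?thesis .
  qed
  \<comment> \<open>The cut is made at u = k. Beyond it the trivial bound 2^k exp (- u) contributes
    about (2 exp (- (1 - s)))^k, which is at most 1 because ln 2 + s < 1.\<close>
  have "norm (mellin f z) \<le> 2 * (M * (exp (Re z * real k) / Re z)
      + 2 ^ k * (exp (- (1 - Re z) * real k) / (1 - Re z))) + norm (mellin f (of_real (Re z)))"
  proof (rule mellin_one_sided_bound)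
    show "f \<in> borel_measurable borel" unfolding f_def[abs_def] by measurable
    have "integrable lborel (\<lambda>u. norm (of_real (log_cyclo A u) * exp (z * of_real u)))"
      by (rule integrable_norm[OF integrable_log_cyclo]) (use A s in auto)
    then show "integrable lborel (\<lambda>u. f u * exp (Re z * u))"
    proof (rule Bochner_Integration.integrable_bound)
      show "(\<lambda>u. f u * exp (Re z * u)) \<in> borel_measurable lborel"
        unfolding f_def[abs_def] by measurable
      show "AE u in lborel. norm (f u * exp (Re z * u)) \<le> norm (norm (of_real (log_cyclo A u) * exp (z * of_real u)))"
        using sgn by (intro AE_I2) (simp add: f_def norm_mult norm_exp_mult_of_real abs_mult)
    qed
    show "f u \<le> M" if "u \<le> real k" for u using le(1) that by (simp add: f_def k_def)
    show "f u \<le> 2 ^ k * exp (- u)" if "u \<ge> real k" for u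
    proof -
      have "f u \<le> \<bar>log_cyclo A u\<bar>" using sgn by (simp add: f_def abs_if split: if_splits)
      also have "\<dots> \<le> 2 ^ k * (- base_log u)" unfolding k_def by (rule abs_log_cyclo_le[OF A])
      also have "\<dots> \<le> 2 ^ k * exp (- u)" using base_log_bounds(2) by (intro mult_left_mono) auto
      finally show ?thesis .
    qed
  qed (use s le in auto)
  moreover have "M * (exp (Re z * real k) / Re z) \<le> 2 * (M * l * exp (real k / l))"
  proof -
    have "exp (Re z * real k) \<le> exp (real k / l)"
      using ln2 l by (simp add: Re_z divide_right_mono mult_left_le_one_le)
    moreover have "1 / Re z \<le> 2 * l" using ln2 l by (simp add: Re_z field_simps)
    ultimately have "M * (exp (Re z * real k) * (1 / Re z)) \<le> M * (exp (real k / l) * (2 * l))"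
      using s le(2) by (intro mult_left_mono mult_mono) auto
    then show ?thesis by (simp add: mult_ac)
  qed
  moreover have "2 ^ k * (exp (- (1 - Re z) * real k) / (1 - Re z)) \<le> 2"
  proof -
    have "(2::real) ^ k = exp (ln 2 * real k)" by (simp add: exp_of_nat2_mult)
    then have "2 ^ k * exp (- (1 - Re z) * real k) = exp ((ln 2 + Re z - 1) * real k)"
      by (simp add: algebra_simps flip: exp_add)
    also have "\<dots> \<le> 1" using ln2 s by (simp add: mult_nonpos_nonneg)
    finally have "2 ^ k * exp (- (1 - Re z) * real k) / (1 - Re z) \<le> 1 / (1 - Re z)"
      using s by (intro divide_right_mono) auto
    also have "\<dots> \<le> 2" using s by (simp add: field_simps)
    finally show ?thesis by simp
  qed
  moreover have "4 * M * l * exp (real k / l) = 4 * (M * l * exp (real k / l))" by simp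
  ultimately show ?thesis using large small unfolding k_def[symmetric] l_def[symmetric] by argo
qed

section \<open>A Chebyshev bound\<close>

text \<open>The numbers 1 / (k C(n,k)) are the entries of Leibniz' harmonic triangle.\<close>

lemma leibniz_triangle:
  assumes "1 \<le> k" "k < n"
  shows "1 / (real k * real (n choose k)) + 1 / (real (k + 1) * real (n choose (k + 1)))
    = 1 / (real k * real ((n - 1) choose k))"
proof -
  define m where "m = n - 1"
  have n: "n = Suc m" "k \<le> m" using assms by (auto simp: m_def)
  define c where "c = real (m choose k)"
  have c: "c > 0" using n by (simp add: c_def)
  have "Suc k * (Suc m choose Suc k) = Suc m * (m choose k)"
    by (rule Suc_times_binomial)
  then have 1: "real (k + 1) * real (n choose (k + 1)) = real n * c"
    unfolding n(1) c_def by (metis Suc_eq_plus1 of_nat_mult)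
  have "(Suc m - k) * (Suc m choose k) = Suc m * (m choose k)"
    using binomial_absorb_comp[of "Suc m" k] n by simp
  then have 2: "(real n - real k) * real (n choose k) = real n * c"
    using n unfolding c_def by (metis le_SucI of_nat_diff of_nat_mult)
  have nk: "real n - real k > 0" "real k > 0" using assms by auto
  have 3: "real (n choose k) = real n * c / (real n - real k)"
    using 2 nk(1) by (metis less_irrefl mult.commute nonzero_eq_divide_eq)
  have "1 / (y * (x * c / (x - y))) + 1 / (x * c) = 1 / (y * c)" if "x - y > 0" "y > 0" for x y
    using that c by (simp add: field_simps)
  then show ?thesis using nk by (simp only: 1 3 m_def[symmetric] c_def[symmetric])
qed

text \<open>K times any entry of the first \<open>N\<close> rows of the harmonic triangle is an
  integer: this holds on the edge 1 / n by hypothesis, and the recurrence carries it inwards. It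
  gives n C(2n,n) | lcm (1, ..., 2n).\<close>

lemma mult_binomial_dvd:
  fixes K :: nat
  assumes "\<And>i. 1 \<le> i \<Longrightarrow> i \<le> N \<Longrightarrow> i dvd K" "1 \<le> k" "k \<le> n" "n \<le> N"
  shows "k * (n choose k) dvd K"
proof -
  have key: "real K / (real k * real (n choose k)) \<in> \<int>"
    using assms(2-4)
  proof (induction n arbitrary: k)
    case (Suc n)
    show ?case using Suc.prems(2,1)
    proof (induction rule: inc_induct)
      case base
      have "Suc n dvd K" using assms(1) Suc.prems by auto
      then obtain j where "K = Suc n * j" ..
      then have "real K / (real (Suc n) * real (Suc n choose Suc n)) = of_nat j"
        by (simp only: of_nat_mult) simp
      then show ?case by (simp only: Ints_of_nat)
    next
      case (step k)
      have "real K * (1 / (real k * real (Suc n choose k))) + real K * (1 / (real (k + 1) * real (Suc n choose (k + 1))))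
        = real K * (1 / (real k * real (n choose k)))"
        unfolding distrib_left[symmetric] using leibniz_triangle[of k "Suc n"] step by simp
      moreover have "real K / (real k * real (n choose k)) \<in> \<int>" using step Suc.prems by (intro Suc.IH) auto
      moreover have "real K / (real (Suc k) * real (Suc n choose Suc k)) \<in> \<int>" using step by auto
      ultimately have "real K / (real k * real (Suc n choose k))
          = real K / (real k * real (n choose k)) - real K / (real (Suc k) * real (Suc n choose Suc k))"
        by simp
      then show ?case using \<open>real K / (real k * real (n choose k)) \<in> \<int>\<close>
          \<open>real K / (real (Suc k) * real (Suc n choose Suc k)) \<in> \<int>\<close> by (simp only: Ints_diff)
    qed
  qed auto
  have "k * (n choose k) > 0" using assms by simp
  then have pos: "real k * real (n choose k) \<noteq> 0" by simp
  from key obtain x where x: "real K / (real k * real (n choose k)) = of_int x" by (auto elim: Ints_cases)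
  then have "real K = of_int x * real (k * (n choose k))" using pos by (simp add: field_simps)
  then have "real_of_int (int K) = of_int (x * int (k * (n choose k)))" by simp
  then have "int K = x * int (k * (n choose k))" by (simp only: of_int_eq_iff)
  then have "int (k * (n choose k)) dvd int K" by simp
  then show ?thesis by (simp only: int_dvd_int_iff)
qed

text \<open>\<open>K\<close> is lcm (1, ..., N), the product over the primes of their largest powers
  not exceeding \<open>N\<close>; each factor is at most \<open>N\<close>.\<close>

lemma primes_upto_power:
  assumes "N > 0"
  obtains K :: nat where "K > 0" "\<And>i. 1 \<le> i \<Longrightarrow> i \<le> N \<Longrightarrow> i dvd K" "K \<le> N ^ card {p. prime p \<and> p \<le> N}"
proof -
  let ?P = "{p. prime p \<and> p \<le> N}"
  define e where "e p = (GREATEST e. p ^ e \<le> N)" for p :: nat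
  define K where "K = (\<Prod>p\<in>?P. p ^ e p)"
  have fin: "finite ?P" by (rule finite_subset[of _ "{..N}"]) auto
  have bound: "\<forall>y. p ^ y \<le> N \<longrightarrow> y \<le> N" if "prime p" for p
  proof (intro allI impI)
    fix y assume "p ^ y \<le> N"
    moreover have "y < p ^ y" using prime_gt_1_nat[OF that] by (simp add: power_gt_expt)
    ultimately show "y \<le> N" by simp
  qed
  have e: "p ^ e p \<le> N" if "prime p" for p
    unfolding e_def by (rule GreatestI_nat[of _ 0 N]) (use assms bound[OF that] in auto)
  have e_max: "x \<le> e p" if "prime p" "p ^ x \<le> N" for p x
    unfolding e_def by (rule Greatest_le_nat[of _ _ N]) (use bound that in auto)
  have "K > 0" unfolding K_def by (intro prod_pos) (auto simp: prime_gt_0_nat)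
  moreover have "i dvd K" if i: "1 \<le> i" "i \<le> N" for i
  proof -
    have "i = (\<Prod>p\<in>prime_factors i. p ^ multiplicity p i)"
      using i prod_prime_factors[of i] by simp
    also have "\<dots> dvd (\<Prod>p\<in>prime_factors i. p ^ e p)"
    proof (rule prod_dvd_prod)
      fix p assume p: "p \<in> prime_factors i"
      then have "p ^ multiplicity p i \<le> N" using i dvd_imp_le[OF multiplicity_dvd[of p i]] by simp
      then show "p ^ multiplicity p i dvd p ^ e p" using p by (intro le_imp_power_dvd e_max) auto
    qed
    also have "\<dots> dvd K" unfolding K_def
    proof (intro prod_dvd_prod_subset fin subsetI)
      fix p assume "p \<in> prime_factors i"
      then have "prime p" "p \<le> i" using i by (auto intro: dvd_imp_le)
      then show "p \<in> ?P" using i by simp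
    qed
    finally show ?thesis .
  qed
  moreover have "K \<le> N ^ card ?P"
  proof -
    have "K \<le> (\<Prod>p\<in>?P. N)" unfolding K_def using e by (intro prod_mono) auto
    then show ?thesis by simp
  qed
  ultimately show ?thesis using that by blast
qed

text \<open>Compare n C(2n,n) <= lcm (1, ..., 2n) <= (2n)^pi(2n) with C(2n,n) >= 4^n / (2n); the
  factor n cancels the loss in the binomial bound.\<close>

lemma prime_count_lower:
  assumes "n \<ge> 1"
  shows "real n * ln 4 - ln 2 \<le> real (card {p. prime p \<and> p \<le> 2 * n}) * ln (2 * real n)"
proof -
  obtain K where K: "K > 0" "\<And>i. 1 \<le> i \<Longrightarrow> i \<le> 2 * n \<Longrightarrow> i dvd K"
    "K \<le> (2 * n) ^ card {p. prime p \<and> p \<le> 2 * n}"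
    using primes_upto_power[of "2 * n"] assms by auto
  have "n * (2 * n choose n) dvd K"
    using mult_binomial_dvd[of "2 * n" K n "2 * n"] K(2) assms by auto
  then have "n * (2 * n choose n) \<le> K" using K(1) by (rule dvd_imp_le)
  then have "n * (2 * n choose n) \<le> (2 * n) ^ card {p. prime p \<and> p \<le> 2 * n}" using K(3) by simp
  then have 1: "real n * real (2 * n choose n) \<le> (2 * real n) ^ card {p. prime p \<and> p \<le> 2 * n}"
    by (drule_tac of_nat_mono[where 'a = real]) simp
  have "4 ^ n / (2 * real n) \<le> real (2 * n choose n)"
    using assms by (intro central_binomial_lower_bound) auto
  then have "4 ^ n / 2 \<le> real n * real (2 * n choose n)" using assms by (simp add: field_simps)
  with 1 have "4 ^ n / 2 \<le> (2 * real n) ^ card {p. prime p \<and> p \<le> 2 * n}" by simp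
  then have "ln (4 ^ n / 2) \<le> ln ((2 * real n) ^ card {p. prime p \<and> p \<le> 2 * n})"
    using assms by (intro ln_mono) auto
  also have "ln ((2 * real n) ^ card {p. prime p \<and> p \<le> 2 * n}) = real (card {p. prime p \<and> p \<le> 2 * n}) * ln (2 * real n)"
    by (simp only: ln_realpow)
  finally show ?thesis by (simp add: ln_div ln_realpow)
qed

text \<open>With ln 2 lowered to 1/2, there are at least (N - 2) / (2 ln N) primes up to N. The gap
  between 1/2 and 1/4 absorbs the at most sqrt N + 1 small ones.\<close>

lemma prime_window_count:
  "\<forall>\<^sub>F N in sequentially. real N / (4 * ln (real N)) \<le> real (card {p. prime p \<and> sqrt (real N) \<le> real p \<and> p \<le> N})"
proof -
  have "\<forall>\<^sub>F N in sequentially. real N / (4 * ln (real N)) \<le> (real N - 2) * (1 / 2) / ln (real N) - sqrt (real N) - 1"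
    by real_asymp
  then show ?thesis using eventually_ge_at_top[of 2]
  proof eventually_elim
    case (elim N)
    define n where "n = N div 2"
    have n: "n \<ge> 1" "2 * n \<le> N" "real N \<le> 2 * real n + 1" using elim(2) by (auto simp: n_def)
    let ?P = "{p. prime p \<and> p \<le> N}" and ?W = "{p. prime p \<and> sqrt (real N) \<le> real p \<and> p \<le> N}"
    have fin: "finite ?P" "finite ?W" by (rule finite_subset[of _ "{..N}"], auto)+
    have "(real N - 2) * (1 / 2) \<le> real n * ln 4 - ln 2"
    proof -
      have "(real N - 2) * (1 / 2) \<le> (real N - 2) * ln 2"
        using elim(2) ln2_ge_two_thirds by (intro mult_left_mono) auto
      moreover
      have "ln (4::real) = 2 * ln 2" using ln_realpow[of 2 2] by simp
      then have "real n * ln 4 - ln 2 = (2 * real n - 1) * ln 2" by (simp add: algebra_simps)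
      moreover have "(real N - 2) * ln 2 \<le> (2 * real n - 1) * ln 2" using n by (intro mult_right_mono) auto
      ultimately show ?thesis by linarith
    qed
    also have "\<dots> \<le> real (card {p. prime p \<and> p \<le> 2 * n}) * ln (2 * real n)"
      by (rule prime_count_lower[OF n(1)])
    also have "\<dots> \<le> real (card ?P) * ln (real N)"
      using n fin elim(2) by (intro mult_mono of_nat_mono card_mono) auto
    finally have "(real N - 2) * (1 / 2) / ln (real N) \<le> real (card ?P)"
      using elim(2) by (simp add: divide_le_eq)
    moreover have "real (card ?P) \<le> real (card ?W) + (sqrt (real N) + 1)"
    proof -
      have "?P \<subseteq> ?W \<union> {..nat \<lfloor>sqrt (real N)\<rfloor>}" by (auto simp: le_nat_iff le_floor_iff)
      then have "card ?P \<le> card (?W \<union> {..nat \<lfloor>sqrt (real N)\<rfloor>})" using fin by (intro card_mono) auto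
      also have "\<dots> \<le> card ?W + card {..nat \<lfloor>sqrt (real N)\<rfloor>}" by (rule card_Un_le)
      finally have "real (card ?P) \<le> real (card ?W + card {..nat \<lfloor>sqrt (real N)\<rfloor>})"
        by (simp only: of_nat_le_iff)
      also have "\<dots> \<le> real (card ?W) + (sqrt (real N) + 1)" by simp
      finally show ?thesis .
    qed
    ultimately show ?case using elim(1) by linarith
  qed
qed

section \<open>Choice of parameters\<close>

text \<open>A bound M = exp (k/6) would contradict \<open>log_cyclo_large\<close>: 1.3^k >= exp
  (k/5), since e <= 3 <= 1.3^5, and k <= N <= k^2 keeps ln N of order ln k. The sign
  \<open>s\<close> gives large and small values of Phi alike.\<close>

lemma log_cyclo_exceeds:
  "\<forall>\<^sub>F k in sequentially. \<forall>A N s. finite A \<longrightarrow> card A = k \<longrightarrow>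
    (\<forall>p\<in>A. prime p \<and> sqrt (real N) \<le> real p \<and> p \<le> N) \<longrightarrow> k \<le> N \<longrightarrow> N \<le> k ^ 2 \<longrightarrow> \<bar>s\<bar> = 1 \<longrightarrow>
    (\<exists>u\<le>real k. s * log_cyclo A u > exp (real k / 6))"
proof -
  have "\<forall>\<^sub>F k in sequentially. exp (real k / 5) > 8 * exp (real k / 6) * ln (real k) * exp (real k / ln (real k)) + 4
      + (16 * ln (real k) ^ 2 + 3)"
    by real_asymp
  moreover have "\<forall>\<^sub>F k in sequentially. ln (real k) \<ge> 12" by real_asymp
  ultimately show ?thesis
  proof eventually_elim
    case (elim k)
    show ?case
    proof (intro allI impI, rule ccontr)
      fix A N and s :: real
      assume A: "finite A" "card A = k" "\<forall>p\<in>A. prime p \<and> sqrt (real N) \<le> real p \<and> p \<le> N"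
        and N: "k \<le> N" "N \<le> k ^ 2" and s: "\<bar>s\<bar> = 1"
        and no: "\<not> (\<exists>u\<le>real k. s * log_cyclo A u > exp (real k / 6))"
      have k0: "k > 0" using elim(2) by (cases "k = 0") auto
      have lnN: "ln (real k) \<le> ln (real N)" using N k0 by (intro ln_mono) auto
      have "ln (real N) \<le> ln (real (k ^ 2))" using N k0 by (intro ln_mono) (auto simp flip: of_nat_power)
      then have lnN': "ln (real N) \<le> 2 * ln (real k)" by (simp add: ln_realpow)
      let ?l = "ln (real N)" and ?m = "ln (real k)"
      have "(13 / 10) ^ k \<le> 4 * exp (real k / 6) * ?l * exp (real k / ?l) + 4 + (4 * ?l ^ 2 + 3) / 2 ^ k"
        using log_cyclo_large[of A N s "exp (real k / 6)"] A elim(2) lnN s no by (auto simp: not_less)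
      also have "\<dots> \<le> 4 * exp (real k / 6) * (2 * ?m) * exp (real k / ?m) + 4 + (4 * (2 * ?m) ^ 2 + 3) / 2 ^ k"
        using lnN lnN' elim(2)
        by (intro add_mono divide_right_mono mult_mono power_mono divide_left_mono order_refl) (auto intro: divide_left_mono)
      also have "\<dots> \<le> 4 * exp (real k / 6) * (2 * ?m) * exp (real k / ?m) + 4 + (4 * (2 * ?m) ^ 2 + 3) / 1"
        by (intro add_mono divide_left_mono order_refl) auto
      also have "\<dots> < exp (real k / 5)" using elim(1) by (simp add: power_mult_distrib)
      also have "\<dots> \<le> (13 / 10) ^ k"
      proof -
        have "exp (1 / 5 :: real) ^ 5 = exp 1" by (simp flip: exp_of_nat_mult)
        also have "\<dots> \<le> 3" by (rule exp_le)
        also have "\<dots> \<le> (13 / 10) ^ 5" by (simp add: eval_nat_numeral)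
        finally have "exp (1 / 5 :: real) \<le> 13 / 10" by (rule power_le_imp_le_base[of _ 4, simplified]) auto
        then have "exp (1 / 5 :: real) ^ k \<le> (13 / 10) ^ k" by (intro power_mono) auto
        then show ?thesis by (simp flip: exp_of_nat_mult)
      qed
      finally show False by simp
    qed
  qed
qed

lemma many_terms_if_large:
  "\<forall>\<^sub>F k in sequentially. \<forall>(G::int poly) B d u. 0 < B \<longrightarrow> ln B + 1 \<le> real k ^ 11 \<longrightarrow>
    real d \<le> real k ^ 4 * exp (2 * real k * ln (real k)) \<longrightarrow>
    (\<forall>x\<ge>1. norm (poly (int_to_cpx_poly G) (of_real x)) \<le> B * x ^ d) \<longrightarrow> u \<le> real k \<longrightarrow>
    exp (exp (real k / 6)) \<le> norm (poly (int_to_cpx_poly G) (of_real (exp (- exp u)))) \<longrightarrow>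
    exp (real k / 8) < real (card (supp G))"
proof -
  \<comment> \<open>\<open>X k\<close> bounds t T d for t = exp u <= exp k and T <= exp (k/8) terms.
    Its logarithm is O(k ln k), so few terms would give a value with logarithm at most k^11 + k^2
    exp (k/8), less than exp (k/6).\<close>
  define X where "X k = exp (real k) * exp (real k / 8) * (real k ^ 4 * exp (2 * real k * ln (real k)))" for k :: nat
  have "\<forall>\<^sub>F k in sequentially. exp (real k / 6) > real k ^ 11 + exp (real k / 8) * real k ^ 2"
    by real_asymp
  moreover have "\<forall>\<^sub>F k in sequentially. ln (2 * X k + 3) \<le> real k ^ 2"
    unfolding X_def by real_asymp
  moreover have "\<forall>\<^sub>F k in sequentially. X k > 0" unfolding X_def by real_asymp
  ultimately show ?thesis
  proof eventually_elim
    case (elim k)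
    show ?case
    proof (intro allI impI, rule ccontr)
      fix G :: "int poly" and B u :: real and d :: nat
      assume B: "0 < B" "ln B + 1 \<le> real k ^ 11" and d: "real d \<le> real k ^ 4 * exp (2 * real k * ln (real k))"
        and G: "\<forall>x\<ge>1. norm (poly (int_to_cpx_poly G) (of_real x)) \<le> B * x ^ d" and u: "u \<le> real k"
        and large: "exp (exp (real k / 6)) \<le> norm (poly (int_to_cpx_poly G) (of_real (exp (- exp u))))"
        and "\<not> exp (real k / 8) < real (card (supp G))"
      then have T: "real (card (supp G)) \<le> exp (real k / 8)" by simp
      define L where "L = nat \<lceil>X k\<rceil>"
      have L: "L > 0" "X k \<le> real L" "real L \<le> X k + 1" using elim(3) by (auto simp: L_def)
      have "exp u * real (card (supp G)) * real d \<le> exp (real k) * exp (real k / 8) * (real k ^ 4 * exp (2 * real k * ln (real k)))"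
        using u T d by (intro mult_mono) auto
      then have "exp u * real (card (supp G)) * real d \<le> real L" using L(2) by (simp add: X_def)
      then have "norm (poly (int_to_cpx_poly G) (of_real (exp (- exp u)))) \<le> B * exp 1 * (2 * real L + 1) ^ card (supp G)"
        using G B L(1) by (intro norm_int_poly_sparse_le) auto
      with large have "exp (exp (real k / 6)) \<le> B * exp 1 * (2 * real L + 1) ^ card (supp G)" by linarith
      then have "ln (exp (exp (real k / 6))) \<le> ln (B * exp 1 * (2 * real L + 1) ^ card (supp G))"
        using B by (intro ln_mono) auto
      also have "\<dots> = ln B + 1 + real (card (supp G)) * ln (2 * real L + 1)"
      proof -
        have "2 * real L + 1 > 0" by simp
        then show ?thesis using B(1) by (simp add: ln_mult ln_realpow)
      qed
      also have "\<dots> \<le> real k ^ 11 + exp (real k / 8) * real k ^ 2"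
      proof (intro add_mono mult_mono)
        have "ln (2 * real L + 1) \<le> ln (2 * X k + 3)" using L by (intro ln_mono) auto
        then show "ln (2 * real L + 1) \<le> real k ^ 2" using elim(2) by linarith
      qed (use B T in auto)
      finally show False using elim(1) by simp
    qed
  qed
qed

lemma ex_sparse_with_dense_factors:
  "\<forall>\<^sub>F k in sequentially. \<forall>A N r. finite A \<longrightarrow> card A = k \<longrightarrow>
    (\<forall>p\<in>A. prime p \<and> sqrt (real N) \<le> real p \<and> p \<le> N) \<longrightarrow> k \<le> N \<longrightarrow> N \<le> k ^ 2 \<longrightarrow> 0 < r \<longrightarrow> r + 1 \<le> k ^ 4 \<longrightarrow>
    (\<exists>F::rat poly. card (supp F) = r + 2 + (\<Sum>p\<in>A. p - 1) \<and>
      (\<forall>G. irreducible G \<and> G dvd F \<longrightarrow> exp (real k / 8) < real (card (supp G))))"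
proof -
  have "\<forall>\<^sub>F k in sequentially. ln (real k ^ 2 * (exp (2 * real k ^ 8 * ln (2 * real k ^ 8)) + 1) + 2 * real k ^ 4) + 1 \<le> real k ^ 11"
    by real_asymp
  moreover note log_cyclo_exceeds many_terms_if_large eventually_gt_at_top[of 0]
  ultimately show ?thesis
  proof eventually_elim
    case (elim k)
    note exceeds = elim(2)[rule_format] and many = elim(3)[rule_format]
    show ?case
    proof (intro allI impI)
      fix A :: "nat set" and N r :: nat
      assume hA: "finite A" "card A = k" "\<forall>p\<in>A. prime p \<and> sqrt (real N) \<le> real p \<and> p \<le> N"
        and hN: "k \<le> N" "N \<le> k ^ 2" and hr: "0 < r" "r + 1 \<le> k ^ 4"
      \<comment> \<open>A prime beyond r (r + 1) outweighs the tail, and one beyond k leaves a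
        positive weight l - (k - 1) for \<open>p0\<close> when all other weights are 1. From q <= 2
        k^8 and l <= q! + 1 the logarithm of l is of order k^8 ln k, within the allowed
        k^11.\<close>
      define q where "q = r * (r + 1) + k"
      obtain l :: nat where l: "prime l" "q < l" "l \<le> fact q + 1" using next_prime_bound by blast
      have "A \<noteq> {}" using hA elim(4) by auto
      then obtain p0 where p0: "p0 \<in> A" by blast
      define c where "c p = (if p = p0 then int l - int (k - 1) else 1)" for p
      have sum_c: "(\<Sum>p\<in>A. c p) = int l"
      proof -
        have "(\<Sum>p\<in>A. c p) = c p0 + (\<Sum>p\<in>A - {p0}. c p)" using hA p0 by (intro sum.remove) auto
        also have "(\<Sum>p\<in>A - {p0}. c p) = (\<Sum>p\<in>A - {p0}. 1)" by (intro sum.cong) (auto simp: c_def)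
        finally show ?thesis using hA p0 by (simp add: c_def)
      qed
      interpret sparse_construction A c r
      proof
        show "c p > 0" for p using l by (auto simp: c_def q_def)
        show "prime (\<Sum>p\<in>A. c p)" unfolding sum_c using l by simp
        have "int (r * (r + 1)) < int l" using l by (simp only: of_nat_less_iff q_def)
        then show "int r * (int r + 1) < (\<Sum>p\<in>A. c p)" unfolding sum_c by (simp add: algebra_simps)
      qed (use hA \<open>A \<noteq> {}\<close> hr in auto)
      obtain P H :: "int poly" where P: "lead_coeff P = 1" "int_to_cpx_poly P = cyclo A" "F = P * H"
        and Pz: "\<And>z. poly (int_to_cpx_poly P) z = 0 \<longleftrightarrow> z \<in> prim_roots A"
        and Hz: "\<And>z. poly (int_to_cpx_poly H) z = 0 \<Longrightarrow> norm z > 1"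
        and H0: "\<bar>coeff H 0\<bar> = (\<Sum>p\<in>A. c p)"
        using cofactors by blast
      define B where "B = real N * (\<Sum>p\<in>A. c p) + 2 * real r"
      define d where "d = (r + 1) * n"
      have le_N: "\<And>p. p \<in> A \<Longrightarrow> p \<le> N" using hA(3) by auto
      have bounds: "norm (poly (int_to_cpx_poly P) (of_real x)) \<le> B * x ^ d"
        "norm (poly (int_to_cpx_poly H) (of_real x)) \<le> B * x ^ d" if "x \<ge> 1" for x
        using norm_cofactors_le[OF P Pz le_N that] unfolding B_def d_def by auto
      have B0: "B > 0" unfolding B_def sum_c using hr by (simp add: add_nonneg_pos)
      have lnB: "ln B + 1 \<le> real k ^ 11"
      proof -
        have k1: "k \<ge> 1" using elim(4) by simp
        have "r * (r + 1) \<le> k ^ 4 * k ^ 4" using hr by (intro mult_mono) auto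
        also have "\<dots> = k ^ 8" by (simp flip: power_add)
        finally have "q \<le> k ^ 8 + k ^ 8" unfolding q_def using self_le_power[OF k1, of 8] by simp
        then have "real q \<le> real (2 * k ^ 8)" by (simp only: of_nat_le_iff)
        then have q: "real q \<le> 2 * real k ^ 8" by simp
        have "q \<ge> 1" using k1 by (simp add: q_def)
        then have q1: "real q \<ge> 1" by simp
        have "real (fact q) \<le> real q ^ q" using fact_le_power[where 'a = real, of q] by simp
        also have "\<dots> = exp (real q * ln (real q))" using q1 by (simp add: exp_of_nat_mult)
        also have "\<dots> \<le> exp (2 * real k ^ 8 * ln (2 * real k ^ 8))"
        proof -
          have "ln (real q) \<le> ln (2 * real k ^ 8)" using q q1 by (intro ln_mono) auto
          then show ?thesis using q q1 by (simp only: exp_le_cancel_iff) (intro mult_mono, auto)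
        qed
        finally have f: "real (fact q) \<le> exp (2 * real k ^ 8 * ln (2 * real k ^ 8))" .
        have "real l \<le> real (fact q + 1)" using l(3) by (simp only: of_nat_le_iff)
        then have "real l \<le> exp (2 * real k ^ 8 * ln (2 * real k ^ 8)) + 1" using f by (simp del: of_nat_fact)
        moreover have "real N \<le> real k ^ 2" using hN(2) by (metis of_nat_le_iff of_nat_power)
        moreover have "real r \<le> real k ^ 4" using hr(2) by (metis of_nat_le_iff of_nat_power add_leD1)
        ultimately have "B \<le> real k ^ 2 * (exp (2 * real k ^ 8 * ln (2 * real k ^ 8)) + 1) + 2 * real k ^ 4"
          unfolding B_def sum_c by (intro add_mono mult_mono) auto
        then have "ln B \<le> ln (real k ^ 2 * (exp (2 * real k ^ 8 * ln (2 * real k ^ 8)) + 1) + 2 * real k ^ 4)"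
          using B0 by (intro ln_mono) auto
        then show ?thesis using elim(1) by linarith
      qed
      have d_le: "real d \<le> real k ^ 4 * exp (2 * real k * ln (real k))"
      proof -
        have "n \<le> (\<Prod>p\<in>A. k ^ 2)" using hA(3) hN(2) by (intro prod_mono) (auto intro: order_trans)
        also have "\<dots> = k ^ (2 * k)" using hA(2) by (simp add: power_mult)
        finally have "d \<le> k ^ 4 * k ^ (2 * k)" unfolding d_def using hr(2) by (intro mult_mono) auto
        then have "real d \<le> real (k ^ 4 * k ^ (2 * k))" by (simp only: of_nat_le_iff)
        also have "\<dots> = real k ^ 4 * real k ^ (2 * k)" by simp
        also have "real k ^ (2 * k) = exp (real (2 * k) * ln (real k))"
          using elim(4) by (simp only: exp_of_nat_mult exp_ln of_nat_0_less_iff)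
        finally show ?thesis by simp
      qed
      have P_exp: "norm (poly (int_to_cpx_poly P) (of_real (exp (- exp u)))) = exp (log_cyclo A u)" for u
        using cyclo_nonzero[of A u] hA(3) by (simp add: P(2) log_cyclo_def)
      have cardP: "exp (real k / 8) < real (card (supp P))"
      proof -
        obtain u where u: "u \<le> real k" "1 * log_cyclo A u > exp (real k / 6)"
          using exceeds[OF hA(1,2) _ hN, of 1] hA(3) by auto
        show ?thesis
          using many[OF B0 lnB d_le bounds(1) u(1)] u(2) by (simp add: P_exp)
      qed
      have cardH: "exp (real k / 8) < real (card (supp H))"
      proof -
        obtain u where u: "u \<le> real k" "-1 * log_cyclo A u > exp (real k / 6)"
          using exceeds[OF hA(1,2) _ hN, of "-1"] hA(3) by auto
        let ?x = "of_real (exp (- exp u))"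
        have "1 \<le> norm (poly (int_to_cpx_poly F) ?x)"
          by (rule norm_F_ge_1) auto
        also have "\<dots> = exp (log_cyclo A u) * norm (poly (int_to_cpx_poly H) ?x)"
          by (simp only: P(3) int_to_cpx_poly_mult poly_mult norm_mult P_exp)
        finally have "exp (- log_cyclo A u) \<le> norm (poly (int_to_cpx_poly H) ?x)"
          by (simp add: exp_minus field_simps)
        moreover have "exp (exp (real k / 6)) \<le> exp (- log_cyclo A u)" using u(2) by simp
        ultimately show ?thesis
          using many[OF B0 lnB d_le bounds(2) u(1)] by linarith
      qed
      show "\<exists>F::rat poly. card (supp F) = r + 2 + (\<Sum>p\<in>A. p - 1) \<and>
        (\<forall>G. irreducible G \<and> G dvd F \<longrightarrow> exp (real k / 8) < real (card (supp G)))"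
      proof (intro exI conjI allI impI)
        show "card (supp (int_to_rat_poly F)) = r + 2 + (\<Sum>p\<in>A. p - 1)"
          using card_supp_F by simp
        fix G :: "rat poly" assume "irreducible G \<and> G dvd int_to_rat_poly F"
        then have "supp G = supp P \<or> supp G = supp H"
          using supp_irreducible_factor[OF P Pz Hz H0] by blast
        then show "exp (real k / 8) < real (card (supp G))" using cardP cardH by auto
      qed
    qed
  qed
qed

theorem theorem1p1:
  shows "\<exists>(c::real) (M::nat). c > 0 \<and>
    (\<forall>m::nat. m \<ge> M \<longrightarrow>
      (\<exists>F::rat poly. card (supp F) = m \<and>
        (\<forall>G::rat poly. irreducible G \<and> G dvd F \<longrightarrow>
          real (card (supp G)) > exp (c * sqrt (real m / ln (real m))))))"
proof -
  obtain k0 where k0: "\<forall>k\<ge>k0. \<forall>A N r. finite A \<longrightarrow> card A = k \<longrightarrow>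
    (\<forall>p\<in>A. prime p \<and> sqrt (real N) \<le> real p \<and> p \<le> N) \<longrightarrow> k \<le> N \<longrightarrow> N \<le> k ^ 2 \<longrightarrow> 0 < r \<longrightarrow> r + 1 \<le> k ^ 4 \<longrightarrow>
    (\<exists>F::rat poly. card (supp F) = r + 2 + (\<Sum>p\<in>A. p - 1) \<and>
      (\<forall>G. irreducible G \<and> G dvd F \<longrightarrow> exp (real k / 8) < real (card (supp G))))"
    using ex_sparse_with_dense_factors unfolding eventually_sequentially ..
  obtain N0 where N0: "\<And>N. N \<ge> N0 \<Longrightarrow> real N / (4 * ln (real N)) \<le>
      real (card {p. prime p \<and> sqrt (real N) \<le> real p \<and> p \<le> N})"
    using prime_window_count unfolding eventually_sequentially by blast
  \<comment> \<open>N will be the integer part of \<open>S m\<close>, and k that of N / (8 ln N).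
    Since ln N >= (ln m) / 2, the sum over \<open>A\<close> is at most k N <= N^2 / (4 ln m) <= m /
    4.\<close>
  define S where "S x = sqrt (x * ln x)" for x :: real
  \<comment> \<open>A lower bound for k without rounding down, so that all requirements on m become
    real asymptotics.\<close>
  define K where "K x = (S x - 1) / (8 * ln x) - 1" for x :: real
  have "\<forall>\<^sub>F m in sequentially. sqrt (real m) \<le> S (real m) - 1" unfolding S_def by real_asymp
  moreover have "\<forall>\<^sub>F m in sequentially. K (real m) \<ge> real k0"
  proof -
    have "filterlim (\<lambda>m. K (real m)) at_top sequentially" unfolding K_def S_def by real_asymp
    then show ?thesis by (simp add: filterlim_at_top)
  qed
  \<comment> \<open>This gives N <= k^2; together with sqrt m <= N it also gives m <= k^4, which
    bounds \<open>r\<close>.\<close>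
  moreover have "\<forall>\<^sub>F m in sequentially. S (real m) \<le> K (real m) ^ 2" unfolding K_def S_def by real_asymp
  moreover have "\<forall>\<^sub>F m in sequentially. real N0 \<le> sqrt (real m)"
  proof -
    have "filterlim (\<lambda>m. sqrt (real m)) at_top sequentially" by real_asymp
    then show ?thesis by (simp add: filterlim_at_top)
  qed
  moreover have "\<forall>\<^sub>F m in sequentially. real m / 4 + 3 \<le> real m" by real_asymp
  \<comment> \<open>K(m) / 8 is asymptotic to sqrt (m / ln m) / 64, which leaves room for the
    constant 1/100.\<close>
  moreover have "\<forall>\<^sub>F m in sequentially. 1 / 100 * sqrt (real m / ln (real m)) < K (real m) / 8"
    unfolding K_def S_def by real_asymp
  moreover have "\<forall>\<^sub>F m in sequentially. ln (real m) \<ge> 2" by real_asymp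
  ultimately have "\<forall>\<^sub>F m in sequentially. \<exists>F::rat poly. card (supp F) = m \<and>
        (\<forall>G::rat poly. irreducible G \<and> G dvd F \<longrightarrow>
          real (card (supp G)) > exp (1 / 100 * sqrt (real m / ln (real m))))"
  proof eventually_elim
    case (elim m)
    define x where "x = real m"
    have x: "ln x \<ge> 2" "x > 0" using elim(7) by (auto simp: x_def intro: Nat.gr0I)
    have "x \<ge> 1" using x by (intro ln_ge_zero_imp_ge_one) linarith+
    have "x \<noteq> 1" using x(1) by auto
    have S0: "S x \<ge> 0" unfolding S_def using x by (intro real_sqrt_ge_zero mult_nonneg_nonneg) linarith+
    define N where "N = nat \<lfloor>S x\<rfloor>"
    have N: "S x - 1 \<le> real N" "real N \<le> S x" using S0 by (auto simp: N_def)
    have sqrtN: "sqrt x \<le> real N" using elim(1) N by (simp add: x_def)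
    have "sqrt x > 0" using x by simp
    have lnN: "ln x / 2 \<le> ln (real N)"
    proof -
      have "ln (sqrt x) \<le> ln (real N)" using sqrtN \<open>sqrt x > 0\<close> by (intro ln_mono) auto
      then show ?thesis using x by (simp add: ln_sqrt)
    qed
    have N_pos: "real N > 0" using sqrtN \<open>sqrt x > 0\<close> by linarith
    have "S x \<le> sqrt (x * x)"
      unfolding S_def using x ln_le_minus_one[of x] by (intro real_sqrt_le_mono mult_left_mono) auto
    then have "real N \<le> x" using N(2) x by simp
    then have lnN': "ln (real N) \<le> ln x" using N_pos by (intro ln_mono)
    define k where "k = nat \<lfloor>real N / (8 * ln (real N))\<rfloor>"
    have k_le: "real k \<le> real N / (8 * ln (real N))"
      unfolding k_def using lnN x by (intro of_nat_floor) auto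
    have k_ge: "K x \<le> real k"
    proof -
      have "(S x - 1) / (8 * ln x) \<le> real N / (8 * ln (real N))"
        using N(1) lnN lnN' x by (intro frac_le) auto
      then show ?thesis unfolding K_def k_def by linarith
    qed
    let ?W = "{p. prime p \<and> sqrt (real N) \<le> real p \<and> p \<le> N}"
    have "real N0 \<le> real N" using elim(4) sqrtN by (simp add: x_def)
    then have W: "real N / (4 * ln (real N)) \<le> real (card ?W)" using N0 by simp
    have "real N / (8 * ln (real N)) \<le> real N / (4 * ln (real N))"
      using lnN x by (intro divide_left_mono) auto
    with k_le W have "k \<le> card ?W" by linarith
    then obtain A where A: "A \<subseteq> ?W" "card A = k" "finite A" by (rule obtain_subset_with_card_n)
    have "real k \<le> real N"
    proof -
      have "real N / (8 * ln (real N)) \<le> real N / 1" using lnN x by (intro divide_left_mono) auto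
      then show ?thesis using k_le by simp
    qed
    have N_le: "real N \<le> real k ^ 2"
    proof -
      have "K x \<ge> 0" using elim(2) by (simp add: x_def)
      then have "K x ^ 2 \<le> real k ^ 2" using k_ge by (intro power_mono)
      then show ?thesis using N(2) elim(3) unfolding x_def by linarith
    qed
    have sum: "real (\<Sum>p\<in>A. p - 1) \<le> x / 4"
    proof -
      have "(\<Sum>p\<in>A. p - 1) \<le> (\<Sum>p\<in>A. N)" using A by (intro sum_mono) auto
      then have "real (\<Sum>p\<in>A. p - 1) \<le> real (k * N)" using A by (simp only: of_nat_le_iff) simp
      also have "\<dots> \<le> real N / (8 * ln (real N)) * real N"
        unfolding of_nat_mult by (rule mult_right_mono[OF k_le]) simp
      also have "\<dots> \<le> real N / (8 * (ln x / 2)) * real N"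
      proof -
        have "8 * (ln x / 2) > 0" "8 * (ln x / 2) \<le> 8 * ln (real N)" using lnN x by linarith+
        then show ?thesis using N_pos by (intro mult_right_mono frac_le) auto
      qed
      also have "\<dots> = real N ^ 2 / (4 * ln x)" by (simp add: power2_eq_square)
      also have "\<dots> \<le> S x ^ 2 / (4 * ln x)"
        using N \<open>x \<ge> 1\<close> by (intro divide_right_mono power_mono) auto
      also have "\<dots> = x / 4" using \<open>x \<noteq> 1\<close> \<open>x \<ge> 1\<close> by (simp add: S_def)
      finally show ?thesis .
    qed
    \<comment> \<open>The tail makes up for the missing terms; the 3 in m / 4 + 3 <= m ensures r >=
      1.\<close>
    define r where "r = m - 2 - (\<Sum>p\<in>A. p - 1)"
    have "real (\<Sum>p\<in>A. p - 1) + 3 \<le> real m" using sum elim(5) unfolding x_def by linarith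
    then have sum': "(\<Sum>p\<in>A. p - 1) + 3 \<le> m" by linarith
    then have r: "r + 2 + (\<Sum>p\<in>A. p - 1) = m" "r > 0" unfolding r_def by linarith+
    have "r + 1 \<le> k ^ 4"
    proof -
      have "x = sqrt x ^ 2" using x by simp
      also have "\<dots> \<le> real N ^ 2" using sqrtN x by (intro power_mono) auto
      also have "\<dots> \<le> (real k ^ 2) ^ 2" using N_le by (intro power_mono) auto
      finally have "real m \<le> real (k ^ 4)" by (simp add: x_def)
      then have "m \<le> k ^ 4" by (simp only: of_nat_le_iff)
      then show ?thesis using r(1) by linarith
    qed
    moreover have "k \<ge> k0" using k_ge elim(2) by (simp add: x_def)
    moreover have "N \<le> k ^ 2" using N_le by (metis of_nat_le_iff of_nat_power)
    moreover have "\<forall>p\<in>A. prime p \<and> sqrt (real N) \<le> real p \<and> p \<le> N" using A(1) by auto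
    ultimately have "\<exists>F::rat poly. card (supp F) = r + 2 + (\<Sum>p\<in>A. p - 1) \<and>
      (\<forall>G. irreducible G \<and> G dvd F \<longrightarrow> exp (real k / 8) < real (card (supp G)))"
      using k0[rule_format, of k A N r] A(2,3) r(2) \<open>real k \<le> real N\<close> by (simp only: of_nat_le_iff)
    then obtain F :: "rat poly" where F: "card (supp F) = r + 2 + (\<Sum>p\<in>A. p - 1)"
      "\<And>G. irreducible G \<and> G dvd F \<Longrightarrow> exp (real k / 8) < real (card (supp G))"
      by blast
    have "1 / 100 * sqrt (x / ln x) < real k / 8" using elim(6) k_ge by (simp add: x_def)
    then have "exp (1 / 100 * sqrt (x / ln x)) < exp (real k / 8)" by simp
    then have exp_less: "exp (1 / 100 * sqrt (real m / ln (real m))) < exp (real k / 8)" by (simp only: x_def)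
    show ?case
    proof (intro exI[of _ F] conjI allI impI)
      show "card (supp F) = m" using F(1) r(1) by simp
      show "exp (1 / 100 * sqrt (real m / ln (real m))) < real (card (supp G))"
        if "irreducible G \<and> G dvd F" for G
        using exp_less F(2)[OF that] by (rule less_trans)
    qed
  qed
  then obtain M where "\<forall>m\<ge>M. \<exists>F::rat poly. card (supp F) = m \<and>
        (\<forall>G::rat poly. irreducible G \<and> G dvd F \<longrightarrow>
          real (card (supp G)) > exp (1 / 100 * sqrt (real m / ln (real m))))"
    unfolding eventually_sequentially by blast
  then show ?thesis by (intro exI[of _ "1 / 100"] exI[of _ M]) auto
qed

end
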